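(* Let $\Bbbk$ be an arbitrary field. For every $d\in[2,\infty]$ there exists a simple finitely generated unital $\Bbbk$-algebra of Gelfand–Kirillov dimension $d$. Moreover, there exists a simple finitely generated unital $\Bbbk$-algebra of quadratic growth.
   Context: For a finitely generated unital $\Bbbk$-algebra $\mathcal{A}$, let $V$ be the $\Bbbk$-linear span of a finite generating set containing the unit and let $V^n$ be the linear span of all products $a_1\cdots a_n$ with $a_i\in V$. The growth of $\mathcal{A}$ is $\gamma(n)=\dim V^n$. The Gelfand–Kirillov dimension of $\mathcal{A}$ is $\limsup_{n\to\infty}\frac{\log\dim V^n}{\log n}$ (independent of the choice of $V$). $\mathcal{A}$ has quadratic growth if there is a constant $C>1$ such that $C^{-1}n^2\le\gamma(n)\le Cn^2$ for all $n\ge 1$ (the property does not depend on the choice of $V$). *)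

theory Defs
  imports Complex_Main "HOL-Library.Extended_Real" "HOL-Library.Liminf_Limsup" "HOL-Library.Poly_Mapping"
begin

text \<open>
  Algebras are associative and unital, not necessarily commutative; the underlying vector space is
  a whole type, the field is a type of class \<open>field\<close>.
\<close>

locale unital_algebra = vector_space scale
  for scale :: "'k::field \<Rightarrow> 'a::ab_group_add \<Rightarrow> 'a" +
  fixes mult :: "'a \<Rightarrow> 'a \<Rightarrow> 'a"
    and unit :: 'a
  assumes mult_assoc: "mult (mult x y) z = mult x (mult y z)"
    and mult_add_left: "mult (x + y) z = mult x z + mult y z"
    and mult_add_right: "mult x (y + z) = mult x y + mult x z"
    and mult_scale_left: "mult (scale c x) y = scale c (mult x y)"
    and mult_scale_right: "mult x (scale c y) = scale c (mult x y)"
    and mult_unit_left: "mult unit x = x"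
    and mult_unit_right: "mult x unit = x"
begin

definition two_sided_ideal :: "'a set \<Rightarrow> bool" where
  "two_sided_ideal I \<longleftrightarrow> subspace I \<and> (\<forall>a. \<forall>x\<in>I. mult a x \<in> I \<and> mult x a \<in> I)"

definition simple_algebra :: bool where
  "simple_algebra \<longleftrightarrow>
     (UNIV :: 'a set) \<noteq> {0} \<and> (\<forall>I. two_sided_ideal I \<longrightarrow> I = {0} \<or> I = UNIV)"

definition subalgebra :: "'a set \<Rightarrow> bool" where
  "subalgebra B \<longleftrightarrow> subspace B \<and> unit \<in> B \<and> (\<forall>x\<in>B. \<forall>y\<in>B. mult x y \<in> B)"

definition generates :: "'a set \<Rightarrow> bool" where
  "generates S \<longleftrightarrow> (\<forall>B. subalgebra B \<and> S \<subseteq> B \<longrightarrow> B = UNIV)"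

definition finitely_generated :: bool where
  "finitely_generated \<longleftrightarrow> (\<exists>S. finite S \<and> generates S)"

definition space_power :: "'a set \<Rightarrow> nat \<Rightarrow> 'a set" where
  "space_power V n = span {foldr mult xs unit | xs. length xs = n \<and> set xs \<subseteq> V}"

definition growth :: "'a set \<Rightarrow> nat \<Rightarrow> nat" where
  "growth S n = dim (space_power (span S) n)"

text \<open>
  The growth rate does not depend on the finite generating set containing the unit, so the two
  notions below ask for it for every such set; finite generation rules out vacuous truth.
\<close>

definition has_gk_dim :: "ereal \<Rightarrow> bool" where
  "has_gk_dim d \<longleftrightarrow> finitely_generated \<and>
     (\<forall>S. finite S \<and> unit \<in> S \<and> generates S \<longrightarrow>
        limsup (\<lambda>n. ereal (ln (real (growth S n)) / ln (real n))) = d)"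

definition quadratic_growth :: bool where
  "quadratic_growth \<longleftrightarrow> finitely_generated \<and>
     (\<forall>S. finite S \<and> unit \<in> S \<and> generates S \<longrightarrow>
        (\<exists>C::real. C > 1 \<and>
           (\<forall>n\<ge>1. inverse C * real n ^ 2 \<le> real (growth S n) \<and>
                  real (growth S n) \<le> C * real n ^ 2)))"

end

text \<open>
  HOL cannot quantify existentially over types, so existence of an algebra needs a fixed carrier
  type. No generality is lost with \<open>nat \<Rightarrow>\<^sub>0 'k\<close>, a \<open>'k\<close>-vector space of
  countably infinite dimension: a finitely generated algebra has countable dimension, and it is
  infinite-dimensional if its Gelfand-Kirillov dimension is nonzero or its growth is quadratic.
  The product and the scalar action on that type are existentially quantified; in particular the
  product is unrelated to the convolution product provided by the type.
\<close>

type_synonym 'k countable_space = "nat \<Rightarrow>\<^sub>0 'k"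

end

theory Submission
  imports Defs "HOL-Library.Function_Algebras" "HOL-Library.Nat_Bijection" "HOL-Library.Countable_Set"
begin

text \<open>
  Attach to a sequence \<open>w :: int \<Rightarrow> 'l\<close> over a finite alphabet the algebra of operators
  on functions on the integers that is generated by the two shifts and by the multiplications with the indicators
  of the sets \<open>{i. w i = l}\<close>. Its elements are the linear operators with a local rule: the value of
  the image at \<open>i\<close> is computed from the argument near \<open>i\<close> by a rule that depends only on
  a window of \<open>w\<close> around \<open>i\<close>. (This is the convolution algebra of the groupoid of germs
  of the shift on the orbit closure of \<open>w\<close>, represented on a single orbit.) Operators of radius
  \<open>c\<close> form a space of dimension \<open>(2 * c + 1) * complexity w c\<close>, where the complexity
  counts the windows of radius \<open>c\<close>, and radius is comparable with word length
  (\<open>local_ops_word_length\<close>). So the growth is that of \<open>n * complexity w n\<close>, up to a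
  linear change of \<open>n\<close>.

  If \<open>w\<close> is uniformly recurrent and not periodic, the algebra is simple
  (\<open>local_alg_ideal_contains_id\<close>). After multiplication by a shift, compressing a nonzero element by the projection onto the
  occurrences of a long window gives a nonzero multiple of this projection, since by aperiodicity the occurrences
  are farther apart than the radius of the element; by recurrence finitely many translates of the occurrences
  cover the integers, which puts the identity into the ideal.

  It remains to find such sequences of complexity about \<open>n powr (\<delta> + 1)\<close>, where
  \<open>\<delta> + 2\<close> is the dimension wanted. They are Toeplitz sequences, filled in successive steps.
  Before step \<open>k\<close> the sequence is known up to holes, both the known values and the holes having
  period \<open>2 ^ k\<close>. An ordinary step fills the holes in every second period with one fixed pattern and
  leaves those in the others open; a doubling step leaves all holes open, so that the longer period has twice as
  many. With \<open>holes k\<close> holes in a period, windows of length about \<open>2 ^ k\<close> number between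
  \<open>2 ^ k * 2 ^ holes k\<close> and twice that, up to a constant factor in the length
  (\<open>complexity_upper\<close>, \<open>complexity_lower\<close>): the first factor is the position modulo the
  period, the second the contents of the holes. Doubling at those even steps where the result stays below
  \<open>\<delta> * (k + 1)\<close> makes \<open>holes k\<close> at most \<open>max 1 (\<delta> * k)\<close> and
  infinitely often at least \<open>\<delta> * k - 2 * \<delta>\<close>, which gives dimension \<open>\<delta> +
  2\<close>. Without any doubling the growth is quadratic, and doubling at every even step gives infinite
  dimension.
\<close>

section \<open>Growth of algebras with a finite-dimensional filtration\<close>

context unital_algebra begin

lemma mult_zero_left: "mult 0 x = 0"
  using mult_scale_left[of 0 0 x] by simp

lemma mult_zero_right: "mult x 0 = 0"
  using mult_scale_right[of x 0 0] by simp

lemma foldr_mult_append: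
  "foldr mult (xs @ ys) unit = mult (foldr mult xs unit) (foldr mult ys unit)"
  by (induction xs) (simp_all add: mult_unit_left mult_assoc)

lemma foldr_mult_replicate_unit: "foldr mult (replicate n unit) unit = unit"
  by (induction n) (simp_all add: mult_unit_left)

lemma subspace_space_power: "subspace (space_power V n)"
  unfolding space_power_def by (rule subspace_span)

lemma foldr_in_space_power:
  assumes "set xs \<subseteq> V" shows "foldr mult xs unit \<in> space_power V (length xs)"
  unfolding space_power_def using assms by (intro span_base) auto

lemma space_power_mult:
  assumes "x \<in> space_power V m" and "y \<in> space_power V n"
  shows "mult x y \<in> space_power V (m + n)"
proof -
  have *: "mult (foldr mult xs unit) y \<in> space_power V (length xs + n)" if "set xs \<subseteq> V" for xs
    using assms(2) unfolding space_power_def[of V n]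
  proof (induction rule: span_induct_alt)
    case base
    show ?case by (simp add: mult_zero_right subspace_0 subspace_space_power)
  next
    case (step c a y)
    then obtain ys where ys: "a = foldr mult ys unit" "length ys = n" "set ys \<subseteq> V" by blast
    have "mult (foldr mult xs unit) a \<in> space_power V (length xs + n)"
      using foldr_in_space_power[of "xs @ ys" V] that ys by (simp add: foldr_mult_append[symmetric])
    with step show ?case
      by (simp add: mult_add_right mult_scale_right subspace_add subspace_scale subspace_space_power)
  qed
  show ?thesis
    using assms(1) unfolding space_power_def[of V m]
  proof (induction rule: span_induct_alt)
    case base
    show ?case by (simp add: mult_zero_left subspace_0 subspace_space_power)
  next
    case (step c a x)
    then obtain xs where "a = foldr mult xs unit" "length xs = m" "set xs \<subseteq> V" by blast
    with * have "mult a y \<in> space_power V (m + n)" by auto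
    with step show ?case
      by (simp add: mult_add_left mult_scale_left subspace_add subspace_scale subspace_space_power)
  qed
qed

lemma unit_in_space_power:
  assumes "unit \<in> V" shows "unit \<in> space_power V n"
proof -
  have "set (replicate n unit) \<subseteq> V" using assms by auto
  from foldr_in_space_power[OF this] show ?thesis
    by (simp only: foldr_mult_replicate_unit length_replicate)
qed

lemma space_power_mono:
  assumes "unit \<in> V" and "m \<le> n" shows "space_power V m \<subseteq> space_power V n"
proof
  fix x assume "x \<in> space_power V m"
  from space_power_mult[OF this unit_in_space_power[OF assms(1), of "n - m"]] assms(2)
  show "x \<in> space_power V n" by (simp add: mult_unit_right)
qed

lemma in_space_power_one: "x \<in> V \<Longrightarrow> x \<in> space_power V 1"
  using foldr_in_space_power[of "[x]" V] by (simp add: mult_unit_right)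

text \<open>
  The union of the powers is a subalgebra, so it is everything once the generators lie in it.
\<close>

lemma generates_imp_in_space_power:
  assumes gen: "generates S" and "S \<subseteq> V" and "unit \<in> V"
  shows "\<exists>n. x \<in> space_power V n"
proof -
  let ?B = "\<Union>n. space_power V n"
  have "subspace ?B"
    unfolding subspace_def
  proof (intro conjI ballI allI)
    show "0 \<in> ?B" using subspace_0[OF subspace_space_power] by blast
  next
    fix x y assume "x \<in> ?B" "y \<in> ?B"
    then obtain m n where "x \<in> space_power V m" "y \<in> space_power V n" by blast
    then have "x \<in> space_power V (max m n)" "y \<in> space_power V (max m n)"
      using space_power_mono[OF assms(3), of m "max m n"]
        space_power_mono[OF assms(3), of n "max m n"] by auto
    then show "x + y \<in> ?B" using subspace_add[OF subspace_space_power] by blast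
  next
    fix c x assume "x \<in> ?B"
    then show "scale c x \<in> ?B" using subspace_scale[OF subspace_space_power] by blast
  qed
  moreover have "unit \<in> ?B" using unit_in_space_power[OF assms(3)] by blast
  moreover have "\<forall>x\<in>?B. \<forall>y\<in>?B. mult x y \<in> ?B"
  proof (intro ballI)
    fix x y assume "x \<in> ?B" "y \<in> ?B"
    then obtain m n where "x \<in> space_power V m" "y \<in> space_power V n" by blast
    then have "mult x y \<in> space_power V (m + n)" by (rule space_power_mult)
    then show "mult x y \<in> ?B" by blast
  qed
  ultimately have "subalgebra ?B" unfolding subalgebra_def by blast
  moreover have "S \<subseteq> ?B" using in_space_power_one assms(2) by blast
  ultimately have "?B = UNIV" using gen unfolding generates_def by blast
  then show ?thesis by blast
qed

lemma space_power_compose: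
  assumes "V \<subseteq> space_power W c"
  shows "space_power V n \<subseteq> space_power W (c * n)"
proof -
  have "foldr mult xs unit \<in> space_power W (c * length xs)" if "set xs \<subseteq> V" for xs
    using that
  proof (induction xs)
    case Nil
    show ?case using foldr_in_space_power[of "[]" W] by simp
  next
    case (Cons x xs)
    then show ?case using space_power_mult[of x W c "foldr mult xs unit" "c * length xs"] assms
      by auto
  qed
  then show ?thesis
    unfolding space_power_def[of V n] by (intro span_minimal subspace_space_power) auto
qed

end

text \<open>
  A filtration by finite-dimensional subspaces that is comparable with word length in some finite
  generating set.  Its dimension function \<open>N\<close> then controls the growth with respect to every
  finite generating set, up to a linear change of the argument.
\<close>

locale filtered_algebra = unital_algebra scale mult unit
  for scale :: "'k::field \<Rightarrow> 'a::ab_group_add \<Rightarrow> 'a" and mult unit +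
  fixes F :: "nat \<Rightarrow> 'a set" and N :: "nat \<Rightarrow> nat" and S0 :: "'a set" and L :: nat
  assumes subspace_F: "subspace (F c)"
    and unit_F: "unit \<in> F 0"
    and mult_F: "\<And>x y. x \<in> F a \<Longrightarrow> y \<in> F b \<Longrightarrow> mult x y \<in> F (a + b)"
    and mono_F: "a \<le> b \<Longrightarrow> F a \<subseteq> F b"
    and exhaust_F: "\<exists>c. x \<in> F c"
    and basis_F: "\<exists>B. finite B \<and> independent B \<and> span B = F c \<and> card B = N c"
    and unit_nonzero: "unit \<noteq> 0"
    and finite_S0: "finite S0" and unit_S0: "unit \<in> S0"
    and word_F: "F c \<subseteq> space_power (span S0) (L * Suc c)"
begin

lemma space_power_le_F:
  assumes "V \<subseteq> F c" shows "space_power V n \<subseteq> F (c * n)"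
proof -
  have "foldr mult xs unit \<in> F (c * length xs)" if "set xs \<subseteq> V" for xs
    using that
  proof (induction xs)
    case Nil
    then show ?case by (simp add: unit_F)
  next
    case (Cons x xs)
    then show ?case using mult_F[of x c "foldr mult xs unit" "c * length xs"] assms by auto
  qed
  then show ?thesis
    unfolding space_power_def by (intro span_minimal subspace_F) auto
qed

lemma finite_subset_F:
  assumes "finite T" shows "\<exists>c\<ge>1. T \<subseteq> F c"
  using assms
proof (induction T)
  case empty
  show ?case by blast
next
  case (insert x T)
  obtain c where c: "c \<ge> 1" "T \<subseteq> F c" using insert by blast
  obtain b where "x \<in> F b" using exhaust_F by blast
  then have "insert x T \<subseteq> F (max b c)"
    using c mono_F[of b "max b c"] mono_F[of c "max b c"] by auto
  with c show ?case by (intro exI[of _ "max b c"]) auto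
qed

lemma generates_S0: "generates S0"
  unfolding generates_def
proof (intro allI impI)
  fix B assume B: "subalgebra B \<and> S0 \<subseteq> B"
  then have sub: "subspace B" and mB: "\<forall>x\<in>B. \<forall>y\<in>B. mult x y \<in> B" and uB: "unit \<in> B"
    unfolding subalgebra_def by auto
  have "span S0 \<subseteq> B" using B sub by (intro span_minimal) auto
  have "foldr mult xs unit \<in> B" if "set xs \<subseteq> span S0" for xs
    using that \<open>span S0 \<subseteq> B\<close> by (induction xs) (use uB mB in auto)
  then have "space_power (span S0) n \<subseteq> B" for n
    unfolding space_power_def using sub by (intro span_minimal) auto
  then show "B = UNIV" using exhaust_F word_F by blast
qed

lemma finitely_generated: "finitely_generated"
  unfolding finitely_generated_def using finite_S0 generates_S0 by blast

text \<open>
  The upper bound holds because a finite set lies in some \<open>F a\<close>; the lower one because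
  \<open>S0\<close> lies in some power of the span of \<open>S\<close>, so that words in \<open>S0\<close> of
  length \<open>n\<close> become words in \<open>S\<close> of length proportional to \<open>n\<close>.
\<close>

lemma growth_comparison:
  assumes "finite S" "unit \<in> S" "generates S"
  shows "\<exists>K\<ge>1. (\<forall>n. growth S n \<le> N (K * n)) \<and> (\<forall>n. N n \<le> growth S (K * Suc n))
                \<and> mono (growth S) \<and> (\<forall>n. growth S n \<ge> 1)"
proof -
  obtain a where a: "a \<ge> 1" "S \<subseteq> F a" using finite_subset_F[OF assms(1)] by blast
  then have SF: "span S \<subseteq> F a" by (intro span_minimal subspace_F)
  have uS: "unit \<in> span S" using assms(2) by (rule span_base)
  have "\<exists>b. \<forall>x\<in>S0. x \<in> space_power (span S) b"
    using finite_S0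
  proof (induction S0)
    case (insert x T)
    obtain b where b: "\<forall>x\<in>T. x \<in> space_power (span S) b" using insert by blast
    obtain c where c: "x \<in> space_power (span S) c"
      using generates_imp_in_space_power[OF assms(3) span_superset uS] by blast
    show ?case
      using b c space_power_mono[OF uS, of b "max b c"] space_power_mono[OF uS, of c "max b c"]
      by (intro exI[of _ "max b c"]) auto
  qed auto
  then obtain b where b: "S0 \<subseteq> space_power (span S) b" by blast
  then have b': "span S0 \<subseteq> space_power (span S) b"
    by (intro span_minimal subspace_space_power)
  define K where "K = max a (b * L)"
  have low: "F n \<subseteq> space_power (span S) (K * Suc n)" for n
  proof -
    have "F n \<subseteq> space_power (span S) (b * (L * Suc n))"
      using word_F space_power_compose[OF b'] by blast
    also have "\<dots> \<subseteq> space_power (span S) (K * Suc n)"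
    proof (rule space_power_mono[OF uS])
      have "b * L * Suc n \<le> K * Suc n" unfolding K_def by (rule mult_le_mono1) simp
      then show "b * (L * Suc n) \<le> K * Suc n" by (simp only: mult.assoc)
    qed
    finally show ?thesis .
  qed
  have up: "space_power (span S) n \<subseteq> F (K * n)" for n
  proof -
    have "space_power (span S) n \<subseteq> F (a * n)" by (rule space_power_le_F[OF SF])
    also have "\<dots> \<subseteq> F (K * n)" by (rule mono_F) (simp add: K_def)
    finally show ?thesis .
  qed
  have dim_bounds: "growth S n \<le> card B" if "finite B" "space_power (span S) n \<subseteq> span B" for n B
    unfolding growth_def using that by (intro dim_le_card) auto
  have dim_low: "card B \<le> growth S n"
    if B: "independent B" "B \<subseteq> space_power (span S) n" for B n
  proof -
    obtain C where C: "C \<subseteq> space_power (span S) n" "independent C"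
      "space_power (span S) n \<subseteq> span C" "card C = growth S n"
      using basis_exists unfolding growth_def by metis
    obtain D where D: "finite D" "span D = F (K * n)" using basis_F by metis
    have "finite C" using independent_span_bound[OF D(1) C(2)] C(1) D(2) up by blast
    then show ?thesis using independent_span_bound[of C B] B C by auto
  qed
  have "growth S n \<le> N (K * n)" for n
    using basis_F[of "K * n"] dim_bounds up by metis
  moreover have "N n \<le> growth S (K * Suc n)" for n
  proof -
    obtain B where B: "independent B" "span B = F n" "card B = N n" using basis_F by metis
    then have "B \<subseteq> space_power (span S) (K * Suc n)" using low span_superset by blast
    with B dim_low show ?thesis by metis
  qed
  moreover have "growth S m \<le> growth S n" if "m \<le> n" for m n
  proof -
    obtain C where C: "C \<subseteq> space_power (span S) m" "independent C"
      "card C = growth S m"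
      using basis_exists unfolding growth_def by metis
    then have "C \<subseteq> space_power (span S) n" using space_power_mono[OF uS that] by blast
    with C dim_low show ?thesis by metis
  qed
  moreover have "K \<ge> 1" using a by (simp add: K_def)
  moreover have "1 \<le> growth S n" for n
    using dim_low[of "{unit}"] unit_in_space_power[OF uS] unit_nonzero by auto
  ultimately show ?thesis by (auto simp: mono_def)
qed

text \<open>
  The linear change of the argument only costs a constant factor, which vanishes after taking logarithms and
  dividing by \<open>ln n\<close>.
\<close>

lemma limsup_growth_le:
  assumes "finite S" "unit \<in> S" "generates S"
    and d: "d \<ge> 0" and N: "\<And>n. n \<ge> 1 \<Longrightarrow> real (N n) \<le> C * real n powr d"
  shows "limsup (\<lambda>n. ereal (ln (real (growth S n)) / ln (real n))) \<le> ereal d"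
proof -
  obtain K where K: "K \<ge> 1" "\<And>n. growth S n \<le> N (K * n)"
    using growth_comparison[OF assms(1-3)] by blast
  define C' where "C' = max 1 (C * real K powr d)"
  have g: "real (growth S n) \<le> C' * real n powr d" if "n \<ge> 1" for n
  proof -
    have "real (growth S n) \<le> real (N (K * n))" using K by simp
    also have "\<dots> \<le> C * real (K * n) powr d" using K that by (intro N) simp
    also have "\<dots> = C * real K powr d * real n powr d" by (simp add: powr_mult)
    also have "\<dots> \<le> C' * real n powr d" unfolding C'_def by (intro mult_right_mono) auto
    finally show ?thesis .
  qed
  have "ln (real (growth S n)) / ln (real n) \<le> d + ln C' / ln (real n)" if "n \<ge> 2" for n
  proof (cases "growth S n = 0")
    case True
    then show ?thesis using that d by (simp add: C'_def)
  next
    case False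
    have pos: "ln (real n) > 0" using that by simp
    have "ln (real (growth S n)) \<le> ln (C' * real n powr d)"
      using False g[of n] that by (intro ln_mono) auto
    also have "\<dots> = ln C' + d * ln (real n)"
      using that by (subst ln_mult) (auto simp: C'_def ln_powr)
    finally show ?thesis using pos by (simp add: field_simps)
  qed
  then have "limsup (\<lambda>n. ereal (ln (real (growth S n)) / ln (real n)))
      \<le> limsup (\<lambda>n. ereal (d + ln C' / ln (real n)))"
    by (intro Limsup_mono) (auto simp: eventually_sequentially)
  also have "(\<lambda>n. d + ln C' / ln (real n)) \<longlonglongrightarrow> d + 0"
    by (intro tendsto_add tendsto_const real_tendsto_divide_at_top[OF tendsto_const]
        filterlim_compose[OF ln_at_top filterlim_real_sequentially])
  then have "limsup (\<lambda>n. ereal (d + ln C' / ln (real n))) = ereal d"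
    by (intro lim_imp_Limsup) auto
  finally show ?thesis .
qed

text \<open>
  A lower bound along some sequence of arguments suffices for a limit superior.
\<close>

lemma limsup_growth_ge:
  assumes "finite S" "unit \<in> S" "generates S"
    and d: "d \<ge> 0" and c: "c > 0"
    and N: "\<And>m. \<exists>n\<ge>m. c * real n powr d \<le> real (N n)"
  shows "ereal d \<le> limsup (\<lambda>n. ereal (ln (real (growth S n)) / ln (real n)))"
proof (rule ccontr)
  let ?X = "\<lambda>n. ereal (ln (real (growth S n)) / ln (real n))"
  assume "\<not> ereal d \<le> limsup ?X"
  then have "limsup ?X < ereal d" by simp
  then obtain y where y: "limsup ?X < ereal y" "ereal y < ereal d"
    using ereal_dense2 by blast
  then have ev: "eventually (\<lambda>n. ?X n < ereal y) sequentially" by (intro Limsup_lessD)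
  obtain K where K: "K \<ge> 1" "\<And>n. N n \<le> growth S (K * Suc n)"
    using growth_comparison[OF assms(1-3)] by blast
  define c' where "c' = c / real (2 * K) powr d"
  have c': "c' > 0" using c K by (simp add: c'_def)
  have "(\<lambda>n. d + ln c' / ln (real n)) \<longlonglongrightarrow> d + 0"
    by (intro tendsto_add tendsto_const real_tendsto_divide_at_top[OF tendsto_const]
        filterlim_compose[OF ln_at_top filterlim_real_sequentially])
  then have "eventually (\<lambda>n. y < d + ln c' / ln (real n)) sequentially"
    using y by (intro order_tendstoD(1)) auto
  with ev obtain m where m: "\<And>n. n \<ge> m \<Longrightarrow> ?X n < ereal y \<and> y < d + ln c' / ln (real n)"
    unfolding eventually_sequentially by (metis (no_types) nle_le order_trans)
  obtain n where n: "n \<ge> max m 2" "c * real n powr d \<le> real (N n)" using N by blast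
  define r where "r = K * Suc n"
  have "Suc n \<le> r" using K unfolding r_def by (metis mult_le_mono1 mult_1)
  then have r: "r \<ge> m" "r \<ge> 2" using n by auto
  have "r \<le> 2 * K * n" using n by (simp add: r_def)
  then have "real r \<le> real (2 * K) * real n" by (metis of_nat_le_iff of_nat_mult)
  then have "real r powr d \<le> (real (2 * K) * real n) powr d" using d by (intro powr_mono2) auto
  then have "c' * real r powr d \<le> c * real n powr d"
    using c K by (simp add: c'_def powr_mult field_simps)
  also have "\<dots> \<le> real (growth S r)"
    using n(2) K(2)[of n] unfolding r_def by (meson of_nat_le_iff order_trans)
  finally have g: "c' * real r powr d \<le> real (growth S r)" .
  have "ln c' + d * ln (real r) = ln (c' * real r powr d)"
    using c' r by (subst ln_mult) (auto simp: ln_powr)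
  also have "\<dots> \<le> ln (real (growth S r))"
    using g c' r by (intro ln_mono) auto
  finally have *: "ln c' + d * ln (real r) \<le> ln (real (growth S r))" .
  have pos: "ln (real r) > 0" using r by simp
  have "d + ln c' / ln (real r) = (ln c' + d * ln (real r)) / ln (real r)"
    using pos by (simp add: field_simps)
  also have "\<dots> \<le> ln (real (growth S r)) / ln (real r)"
    using pos * by (intro divide_right_mono) auto
  finally have "d + ln c' / ln (real r) \<le> ln (real (growth S r)) / ln (real r)" .
  with m[OF r(1)] show False by simp
qed

lemma has_gk_dimI:
  assumes "d \<ge> 0" "c > 0" "\<And>n. n \<ge> 1 \<Longrightarrow> real (N n) \<le> C * real n powr d"
    and "\<And>m. \<exists>n\<ge>m. c * real n powr d \<le> real (N n)"
  shows "has_gk_dim (ereal d)"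
  unfolding has_gk_dim_def
  using finitely_generated limsup_growth_le[OF _ _ _ assms(1,3)]
    limsup_growth_ge[OF _ _ _ assms(1,2,4)] by (auto intro: antisym)

lemma has_gk_dim_infinityI:
  assumes "\<And>d m. d \<ge> 0 \<Longrightarrow> \<exists>n\<ge>m. real n powr d \<le> real (N n)"
  shows "has_gk_dim \<infinity>"
  unfolding has_gk_dim_def
proof (intro conjI allI impI finitely_generated)
  fix S assume S: "finite S \<and> unit \<in> S \<and> generates S"
  let ?l = "limsup (\<lambda>n. ereal (ln (real (growth S n)) / ln (real n)))"
  have "ereal (real n) \<le> ?l" for n
    using S assms[of "real n"] by (intro limsup_growth_ge[where c = 1]) auto
  moreover have "\<exists>n. ereal B \<le> ereal (real n)" for B
    using real_arch_simple[of B] by simp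
  ultimately show "?l = \<infinity>" by (intro ereal_top) (meson order_trans)
qed

lemma quadratic_growthI:
  assumes c: "c > 0" and up: "\<And>n. n \<ge> 1 \<Longrightarrow> real (N n) \<le> C * real n ^ 2"
    and low: "\<And>n. n \<ge> 1 \<Longrightarrow> c * real n ^ 2 \<le> real (N n)"
  shows "quadratic_growth"
  unfolding quadratic_growth_def
proof (intro conjI allI impI finitely_generated)
  fix S assume S: "finite S \<and> unit \<in> S \<and> generates S"
  then obtain K where K: "K \<ge> 1" "\<And>n. growth S n \<le> N (K * n)" "\<And>n. N n \<le> growth S (K * Suc n)"
    "mono (growth S)" "\<And>n. growth S n \<ge> 1"
    using growth_comparison by metis
  define C' where "C' = Max {2, C * real K ^ 2, 1 / c * real (4 * K) ^ 2, real (4 * K) ^ 2}"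
  have C': "C' \<ge> 2" "C' \<ge> C * real K ^ 2" "C' \<ge> 1 / c * real (4 * K) ^ 2"
      "C' \<ge> real (4 * K) ^ 2"
    unfolding C'_def by (rule Max_ge; simp)+
  have u: "real (growth S n) \<le> C' * real n ^ 2" if "n \<ge> 1" for n
  proof -
    have "real (growth S n) \<le> real (N (K * n))" using K by simp
    also have "\<dots> \<le> C * real (K * n) ^ 2" using K that by (intro up) simp
    also have "\<dots> = C * real K ^ 2 * real n ^ 2" by (simp add: power_mult_distrib)
    also have "\<dots> \<le> C' * real n ^ 2" using C' by (intro mult_right_mono) auto
    finally show ?thesis .
  qed
  have l: "inverse C' * real n ^ 2 \<le> real (growth S n)" if "n \<ge> 1" for n
  proof (cases "n < 2 * K")
    case True
    have "real n ^ 2 \<le> real (4 * K) ^ 2" using True by (intro power_mono) auto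
    also have "\<dots> \<le> C' * 1" using C' by simp
    also have "\<dots> \<le> C' * real (growth S n)" using C' K(5)[of n] by (intro mult_left_mono) auto
    finally show ?thesis using C' by (simp add: field_simps)
  next
    case False
    define q where "q = n div K - 1"
    have "n div K \<ge> 2" using False K by (simp add: less_eq_div_iff_mult_less_eq mult.commute)
    then have q: "q \<ge> 1" "n div K = Suc q" by (auto simp: q_def)
    have "n < K * (Suc q + 1)"
      using K q(2) by (metis Suc_eq_plus1 dividend_less_div_times less_le_trans mult.commute
          mult_Suc_right zero_less_one add.commute)
    also have "\<dots> \<le> K * (4 * q)" using q(1) by (intro mult_le_mono2) simp
    finally have "real n \<le> real (4 * K) * real q" by (simp flip: of_nat_mult add: mult.assoc mult.left_commute)
    then have "real n ^ 2 \<le> (real (4 * K) * real q) ^ 2" by (intro power_mono) auto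
    also have "\<dots> = 1 / c * real (4 * K) ^ 2 * (c * real q ^ 2)" using c by (simp add: power_mult_distrib)
    also have "\<dots> \<le> C' * (c * real q ^ 2)" using C' c by (intro mult_right_mono) auto
    also have "\<dots> \<le> C' * real (N q)" using low[OF q(1)] C' by (intro mult_left_mono) auto
    also have "\<dots> \<le> C' * real (growth S (K * Suc q))" using K(3)[of q] C' by (intro mult_left_mono) auto
    also have "\<dots> \<le> C' * real (growth S n)"
    proof -
      have "K * Suc q \<le> n" unfolding q(2)[symmetric] by simp
      then show ?thesis using K(4) C' by (intro mult_left_mono) (auto simp: mono_def)
    qed
    finally show ?thesis using C' by (simp add: field_simps)
  qed
  show "\<exists>C>1. \<forall>n\<ge>1. inverse C * (real n)\<^sup>2 \<le> real (growth S n) \<and> real (growth S n) \<le> C * (real n)\<^sup>2"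
    using u l C'(1) by (intro exI[of _ C']) auto
qed

end

section \<open>Local operators over a sequence\<close>

type_synonym 'k operator = "(int \<Rightarrow> 'k) \<Rightarrow> (int \<Rightarrow> 'k)"

definition op_scale :: "'k::field \<Rightarrow> 'k operator \<Rightarrow> 'k operator" where
  "op_scale c a = (\<lambda>\<xi> i. c * a \<xi> i)"

interpretation op: vector_space op_scale
  by unfold_locales (auto simp: op_scale_def fun_eq_iff algebra_simps)

definition shift :: "int \<Rightarrow> 'k operator" where
  "shift t \<xi> i = \<xi> (i + t)"

definition restrict_to :: "int set \<Rightarrow> 'k::zero operator" where
  "restrict_to X \<xi> i = (if i \<in> X then \<xi> i else 0)"

definition point_mass :: "int \<Rightarrow> int \<Rightarrow> 'k::zero_neq_one" where
  "point_mass j i = (if i = j then 1 else 0)"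

lemma shift_shift: "shift s \<circ> shift t = shift (s + t)"
  by (auto simp: fun_eq_iff shift_def add.assoc)

lemma shift_0: "shift 0 = id"
  by (auto simp: fun_eq_iff shift_def)

lemma restrict_to_Int: "restrict_to X \<circ> restrict_to Y = restrict_to (X \<inter> Y)"
  by (auto simp: fun_eq_iff restrict_to_def)

lemma restrict_to_Un:
  "(restrict_to (X \<union> Y) :: 'k::ab_group_add operator) = restrict_to X + restrict_to Y - (restrict_to Y \<circ> restrict_to X)"
  by (auto simp: fun_eq_iff restrict_to_def)

lemma shift_restrict_to:
  "shift t \<circ> restrict_to X \<circ> shift (- t) = restrict_to {i. i + t \<in> X}"
  by (auto simp: fun_eq_iff restrict_to_def shift_def)

definition agree :: "(int \<Rightarrow> 'l) \<Rightarrow> nat \<Rightarrow> int \<Rightarrow> int \<Rightarrow> bool" where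
  "agree w c i j \<longleftrightarrow> (\<forall>t. \<bar>t\<bar> \<le> int c \<longrightarrow> w (i + t) = w (j + t))"

definition window :: "(int \<Rightarrow> 'l) \<Rightarrow> nat \<Rightarrow> int \<Rightarrow> int \<Rightarrow> 'l option" where
  "window w c i t = (if \<bar>t\<bar> \<le> int c then Some (w (i + t)) else None)"

lemma window_eq_iff: "window w c i = window w c j \<longleftrightarrow> agree w c i j"
  by (auto simp: window_def agree_def fun_eq_iff)

lemma agree_refl: "agree w c i i" by (simp add: agree_def)

lemma agree_sym: "agree w c i j \<Longrightarrow> agree w c j i" by (simp add: agree_def)

lemma agree_mono: "agree w c i j \<Longrightarrow> b \<le> c \<Longrightarrow> agree w b i j"
  by (auto simp: agree_def)

lemma agree_shift:
  assumes "agree w (b + c) i j" "\<bar>t\<bar> \<le> int b" shows "agree w c (i + t) (j + t)"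
  unfolding agree_def
proof (intro allI impI)
  fix s assume "\<bar>s\<bar> \<le> int c"
  then have "\<bar>t + s\<bar> \<le> int (b + c)" using assms(2) by linarith
  then show "w (i + t + s) = w (j + t + s)" using assms(1) by (simp add: agree_def add.assoc)
qed

lemma finite_range_window: "finite (range (window (w :: int \<Rightarrow> 'l::finite) c))"
proof -
  have "range (window w c) \<subseteq> {f. \<forall>t. (t \<in> {- int c..int c} \<longrightarrow> f t \<in> UNIV) \<and> (t \<notin> {- int c..int c} \<longrightarrow> f t = None)}"
    by (auto simp: window_def)
  then show ?thesis by (rule finite_subset) (rule finite_set_of_finite_funs; simp)
qed

definition complexity :: "(int \<Rightarrow> 'l) \<Rightarrow> nat \<Rightarrow> nat" where
  "complexity w c = card (range (window w c))"

text \<open>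
  Linear operators given by a local rule of radius \<open>c\<close>. The rule itself is left implicit: positions
  with the same window and the same argument nearby yield the same value. In this form closure under composition
  needs no sums, the radii simply add.
\<close>

definition local_ops :: "(int \<Rightarrow> 'l) \<Rightarrow> nat \<Rightarrow> 'k::field operator set" where
  "local_ops w c = {a. (\<forall>\<xi> \<eta> i. a (\<xi> + \<eta>) i = a \<xi> i + a \<eta> i) \<and>
      (\<forall>k \<xi> i. a (\<lambda>j. k * \<xi> j) i = k * a \<xi> i) \<and>
      (\<forall>\<xi> \<eta> i j. agree w c i j \<longrightarrow> (\<forall>t. \<bar>t\<bar> \<le> int c \<longrightarrow> \<xi> (i + t) = \<eta> (j + t)) \<longrightarrow> a \<xi> i = a \<eta> j)}"

lemma local_opsI:
  assumes "\<And>\<xi> \<eta> i. a (\<xi> + \<eta>) i = a \<xi> i + a \<eta> i"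
    and "\<And>k \<xi> i. a (\<lambda>j. k * \<xi> j) i = k * a \<xi> i"
    and "\<And>\<xi> \<eta> i j. agree w c i j \<Longrightarrow> (\<And>t. \<bar>t\<bar> \<le> int c \<Longrightarrow> \<xi> (i + t) = \<eta> (j + t)) \<Longrightarrow> a \<xi> i = a \<eta> j"
  shows "a \<in> local_ops w c"
  using assms by (simp add: local_ops_def)

lemma local_opsD:
  assumes "a \<in> local_ops w c"
  shows "a (\<xi> + \<eta>) = a \<xi> + a \<eta>" "a (\<lambda>j. k * \<xi> j) = (\<lambda>j. k * a \<xi> j)"
    and "agree w c i j \<Longrightarrow> (\<And>t. \<bar>t\<bar> \<le> int c \<Longrightarrow> \<xi> (i + t) = \<eta> (j + t)) \<Longrightarrow> a \<xi> i = a \<eta> j"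
  using assms by (auto simp: local_ops_def fun_eq_iff)

lemma local_ops_sum:
  assumes a: "a \<in> local_ops w c" and "finite T"
  shows "a (\<lambda>j. \<Sum>t\<in>T. f t j) = (\<lambda>j. \<Sum>t\<in>T. a (f t) j)"
  using assms(2)
proof (induction T)
  case empty
  show ?case using local_opsD(2)[OF a, of 0 "\<lambda>_. 0"] by (simp add: zero_fun_def)
next
  case (insert t T)
  have "a (\<lambda>j. \<Sum>t\<in>insert t T. f t j) = a (f t + (\<lambda>j. \<Sum>t\<in>T. f t j))"
    using insert by (intro arg_cong[of _ _ a]) (auto simp: fun_eq_iff)
  also have "\<dots> = (\<lambda>j. \<Sum>t\<in>insert t T. a (f t) j)"
    using insert by (simp add: local_opsD(1)[OF a] fun_eq_iff)
  finally show ?case .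
qed

lemma local_ops_mono: "b \<le> c \<Longrightarrow> local_ops w b \<subseteq> (local_ops w c :: 'k::field operator set)"
proof (intro subsetI local_opsI)
  fix a :: "'k operator" and \<xi> \<eta> :: "int \<Rightarrow> 'k" and i j
  assume "b \<le> c" and a: "a \<in> local_ops w b" and "agree w c i j"
    and eq: "\<And>t. \<bar>t\<bar> \<le> int c \<Longrightarrow> \<xi> (i + t) = \<eta> (j + t)"
  then show "a \<xi> i = a \<eta> j"
    by (intro local_opsD(3)[OF a]) (auto intro: agree_mono)
qed (simp_all add: local_opsD(1,2))

lemma subspace_local_ops: "op.subspace (local_ops w c)"
  unfolding op.subspace_def
proof (intro conjI ballI allI)
  show "0 \<in> local_ops w c" by (rule local_opsI) auto
next
  fix a b :: "'a operator" assume a: "a \<in> local_ops w c" and b: "b \<in> local_ops w c"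
  show "a + b \<in> local_ops w c"
  proof (rule local_opsI)
    fix \<xi> \<eta> :: "int \<Rightarrow> 'a" and i j
    assume *: "agree w c i j" "\<And>t. \<bar>t\<bar> \<le> int c \<Longrightarrow> \<xi> (i + t) = \<eta> (j + t)"
    show "(a + b) \<xi> i = (a + b) \<eta> j"
      using local_opsD(3)[OF a *(1), of \<xi> \<eta>] local_opsD(3)[OF b *(1), of \<xi> \<eta>] *(2) by simp
  qed (simp_all add: local_opsD(1,2)[OF a] local_opsD(1,2)[OF b] algebra_simps)
next
  fix k and a :: "'a operator" assume a: "a \<in> local_ops w c"
  show "op_scale k a \<in> local_ops w c"
  proof (rule local_opsI)
    fix \<xi> \<eta> :: "int \<Rightarrow> 'a" and i j
    assume *: "agree w c i j" "\<And>t. \<bar>t\<bar> \<le> int c \<Longrightarrow> \<xi> (i + t) = \<eta> (j + t)"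
    show "op_scale k a \<xi> i = op_scale k a \<eta> j"
      using local_opsD(3)[OF a *(1), of \<xi> \<eta>] *(2) by (simp add: op_scale_def)
  qed (simp_all add: local_opsD(1,2)[OF a] op_scale_def algebra_simps)
qed

lemma local_ops_comp:
  assumes a: "a \<in> local_ops w b" and b: "b' \<in> local_ops w c"
  shows "a \<circ> b' \<in> local_ops w (b + c)"
proof -
  have "a (b' \<xi>) i = a (b' \<eta>) j"
    if ag: "agree w (b + c) i j" and eq: "\<forall>t. \<bar>t\<bar> \<le> int (b + c) \<longrightarrow> \<xi> (i + t) = \<eta> (j + t)" for \<xi> \<eta> i j
  proof (rule local_opsD(3)[OF a])
    show "agree w b i j" using ag by (rule agree_mono) simp
    fix t assume t: "\<bar>t\<bar> \<le> int b"
    show "b' \<xi> (i + t) = b' \<eta> (j + t)"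
    proof (rule local_opsD(3)[OF b agree_shift[OF ag t]])
      fix s assume "\<bar>s\<bar> \<le> int c"
      then have "\<bar>t + s\<bar> \<le> int (b + c)" using t by linarith
      then show "\<xi> (i + t + s) = \<eta> (j + t + s)" using eq by (simp add: add.assoc)
    qed
  qed
  then show ?thesis
    unfolding local_ops_def by (simp add: local_opsD(1,2)[OF a] local_opsD(1,2)[OF b])
qed

lemma id_local_ops: "id \<in> local_ops w 0"
  by (rule local_opsI) (use add_0_right in \<open>force+\<close>)

lemma shift_local_ops: "\<bar>t\<bar> \<le> int c \<Longrightarrow> shift t \<in> local_ops w c"
  by (rule local_opsI) (auto simp: shift_def)

lemma restrict_to_local_ops:
  assumes "\<And>i j. agree w c i j \<Longrightarrow> i \<in> X \<longleftrightarrow> j \<in> X"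
  shows "restrict_to X \<in> local_ops w c"
proof (rule local_opsI)
  fix \<xi> \<eta> :: "int \<Rightarrow> 'b" and i j
  assume ag: "agree w c i j" and eq: "\<And>t. \<bar>t\<bar> \<le> int c \<Longrightarrow> \<xi> (i + t) = \<eta> (j + t)"
  show "restrict_to X \<xi> i = restrict_to X \<eta> j"
    using assms[OF ag] eq[of 0] by (simp add: restrict_to_def)
qed (auto simp: restrict_to_def)

definition occ :: "(int \<Rightarrow> 'l) \<Rightarrow> nat \<Rightarrow> int \<Rightarrow> int set" where
  "occ w c i = {j. agree w c i j}"

lemma restrict_occ_local_ops: "restrict_to (occ w c i) \<in> local_ops w c"
  by (rule restrict_to_local_ops) (auto simp: occ_def agree_def)

definition local_alg :: "(int \<Rightarrow> 'l) \<Rightarrow> 'k::field operator set" where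
  "local_alg w = (\<Union>c. local_ops w c)"

text \<open>
  These operators are matrix units: a local rule of radius \<open>c\<close> amounts to one coefficient for each
  pair of a window and a displacement.
\<close>

definition elem_op :: "(int \<Rightarrow> 'l) \<Rightarrow> nat \<Rightarrow> (int \<Rightarrow> 'l option) \<times> int \<Rightarrow> 'k::field operator" where
  "elem_op w c = (\<lambda>(u, t). restrict_to {i. window w c i = u} \<circ> shift t)"

definition elem_index :: "(int \<Rightarrow> 'l) \<Rightarrow> nat \<Rightarrow> ((int \<Rightarrow> 'l option) \<times> int) set" where
  "elem_index w c = range (window w c) \<times> {- int c..int c}"

lemma elem_op_apply: "elem_op w c (u, t) \<xi> i = (if window w c i = u then \<xi> (i + t) else 0)"
  by (simp add: elem_op_def restrict_to_def shift_def)

lemma elem_op_local_ops: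
  assumes "p \<in> elem_index w c" shows "elem_op w c p \<in> local_ops w c"
proof -
  obtain u t where p: "p = (u, t)" "\<bar>t\<bar> \<le> int c" using assms by (auto simp: elem_index_def)
  show ?thesis
    unfolding local_ops_def p(1) using p(2)
    by (auto simp: elem_op_apply window_eq_iff[symmetric])
qed

lemma finite_elem_index: "finite (elem_index (w :: int \<Rightarrow> 'l::finite) c)"
  by (simp add: elem_index_def finite_range_window)

lemma card_elem_index: "card (elem_index (w :: int \<Rightarrow> 'l::finite) c) = (2 * c + 1) * complexity w c"
proof -
  have "card {- int c..int c} = 2 * c + 1" by simp
  then show ?thesis
    by (simp only: elem_index_def card_cartesian_product complexity_def mult.commute)
qed

lemma elem_op_at:
  assumes "\<bar>t\<bar> \<le> int c" 
  shows "elem_op w c (u, s) (point_mass (i + t)) i = (if u = window w c i \<and> s = t then 1 else 0)"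
  by (auto simp: elem_op_apply point_mass_def)

lemma sum_op_apply: "(\<Sum>p\<in>P. f p) \<xi> i = (\<Sum>p\<in>P. f p \<xi> i)"
  for f :: "'p \<Rightarrow> 'k::field operator"
  by (induction P rule: infinite_finite_induct) auto

text \<open>
  Evaluating at the point mass at \<open>i + t\<close>, in position \<open>i\<close>, isolates the coefficient of
  the window at \<open>i\<close> and the displacement \<open>t\<close>. Hence the elementary operators are
  independent.
\<close>

lemma elem_op_coefficient:
  assumes fin: "finite P" and P: "(window w c i, t) \<in> P" and t: "\<bar>t\<bar> \<le> int c"
  shows "(\<Sum>p\<in>P. op_scale (g p) (elem_op w c p)) (point_mass (i + t)) i = g (window w c i, t)"
proof -
  have "(\<Sum>p\<in>P. op_scale (g p) (elem_op w c p)) (point_mass (i + t)) i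
      = (\<Sum>p\<in>P. if p = (window w c i, t) then g p else 0)"
    unfolding sum_op_apply
    by (rule sum.cong) (auto simp: op_scale_def elem_op_at[OF t] split: prod.split if_splits)
  then show ?thesis using fin P by simp
qed

lemma elem_op_coefficients_zero:
  assumes fin: "finite P" and P: "P \<subseteq> elem_index w c"
    and 0: "(\<Sum>p\<in>P. op_scale (g p) (elem_op w c p)) = 0" and p: "p \<in> P"
  shows "g p = 0"
proof -
  obtain i t where it: "p = (window w c i, t)" "\<bar>t\<bar> \<le> int c"
    using p P unfolding elem_index_def by (auto simp: abs_le_iff dest!: subsetD)
  show ?thesis using elem_op_coefficient[OF fin, of w c i t g] p it 0 by simp
qed

lemma inj_elem_op: "inj_on (elem_op w c :: _ \<Rightarrow> 'k::field operator) (elem_index w c)"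
proof (rule inj_onI)
  fix p q assume p: "p \<in> elem_index w c" and "q \<in> elem_index w c"
    and eq: "elem_op w c p = (elem_op w c q :: 'k operator)"
  obtain i t where it: "p = (window w c i, t)" "\<bar>t\<bar> \<le> int c" using p by (auto simp: elem_index_def)
  have "elem_op w c q (point_mass (i + t)) i = (1::'k)" using eq elem_op_at[OF it(2), of w "window w c i" t i] it
    by (metis (no_types))
  then show "p = q" using it by (cases q) (auto simp: elem_op_at split: if_splits)
qed

lemma independent_elem_op: "op.independent (elem_op w c ` elem_index w c)"
proof -
  have "g a = 0" if fin: "finite T" and T: "T \<subseteq> elem_op w c ` elem_index w c"
      and 0: "(\<Sum>a\<in>T. op_scale (g a) a) = 0" and a: "a \<in> T"
    for T and g :: "'a operator \<Rightarrow> 'a" and a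
  proof -
    obtain P where P: "P \<subseteq> elem_index w c" "T = elem_op w c ` P" using T by (meson subset_imageE)
    have inj: "inj_on (elem_op w c :: _ \<Rightarrow> 'a operator) P" using inj_elem_op P(1) by (rule inj_on_subset)
    have "finite P" using fin P(2) inj by (simp add: finite_image_iff)
    moreover have "(\<Sum>p\<in>P. op_scale (g (elem_op w c p)) (elem_op w c p)) = 0"
      using 0 unfolding P(2) by (simp add: sum.reindex[OF inj])
    moreover obtain p where "p \<in> P" "a = elem_op w c p" using a P(2) by blast
    ultimately show "g a = 0" using elem_op_coefficients_zero[of P w c "\<lambda>p. g (elem_op w c p)" p] P(1) by blast
  qed
  then show ?thesis unfolding op.independent_explicit_module by blast
qed

lemma local_ops_point_expansion:
  assumes a: "a \<in> local_ops w c"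
  shows "a \<xi> i = (\<Sum>t\<in>{- int c..int c}. \<xi> (i + t) * a (point_mass (i + t)) i)"
proof -
  let ?I = "{- int c..int c}"
  have "a \<xi> i = a (\<lambda>j. \<Sum>t\<in>?I. \<xi> (i + t) * point_mass (i + t) j) i"
  proof (rule local_opsD(3)[OF a agree_refl])
    fix s assume s: "\<bar>s\<bar> \<le> int c"
    have "(\<Sum>t\<in>?I. \<xi> (i + t) * point_mass (i + t) (i + s)) = (\<Sum>t\<in>?I. if t = s then \<xi> (i + t) else 0)"
      by (rule sum.cong) (auto simp: point_mass_def)
    also have "\<dots> = \<xi> (i + s)" using s by (simp add: abs_le_iff)
    finally show "\<xi> (i + s) = (\<Sum>t\<in>?I. \<xi> (i + t) * point_mass (i + t) (i + s))" by simp
  qed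
  then show ?thesis by (simp add: local_ops_sum[OF a] local_opsD(2)[OF a])
qed

text \<open>
  The coefficient at \<open>(u, t)\<close> can be read off at any occurrence of \<open>u\<close>, by locality.
\<close>

lemma local_ops_expansion:
  fixes w :: "int \<Rightarrow> 'l::finite"
  assumes a: "a \<in> local_ops w c"
  shows "a = (\<Sum>(u,t)\<in>elem_index w c. 
      op_scale (a (point_mass ((SOME i. window w c i = u) + t)) (SOME i. window w c i = u)) (elem_op w c (u, t)))"
    (is "a = (\<Sum>(u,t)\<in>_. op_scale (?f u t) _)")
proof (intro ext)
  fix \<xi> i
  define I where "I = {- int c..int c}"
  have "a \<xi> i = (\<Sum>t\<in>I. \<xi> (i + t) * a (point_mass (i + t)) i)"
    unfolding I_def by (rule local_ops_point_expansion[OF a])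
  also have "\<dots> = (\<Sum>t\<in>I. \<xi> (i + t) * ?f (window w c i) t)"
  proof (rule sum.cong[OF refl])
    fix t assume "t \<in> I"
    have "agree w c i (SOME j. window w c j = window w c i)"
      by (metis (mono_tags, lifting) someI window_eq_iff)
    then have "a (point_mass (i + t)) i = ?f (window w c i) t"
      by (intro local_opsD(3)[OF a]) (auto simp: point_mass_def)
    then show "\<xi> (i + t) * a (point_mass (i + t)) i = \<xi> (i + t) * ?f (window w c i) t" by simp
  qed
  also have "\<dots> = (\<Sum>u\<in>range (window w c). if u = window w c i then \<Sum>t\<in>I. \<xi> (i + t) * ?f u t else 0)"
    by (simp add: finite_range_window)
  also have "\<dots> = (\<Sum>u\<in>range (window w c). \<Sum>t\<in>I. op_scale (?f u t) (elem_op w c (u, t)) \<xi> i)"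
    by (intro sum.cong) (auto simp: op_scale_def elem_op_apply mult.commute)
  also have "\<dots> = (\<Sum>(u,t)\<in>elem_index w c. op_scale (?f u t) (elem_op w c (u, t)) \<xi> i)"
    by (simp add: elem_index_def I_def sum.cartesian_product)
  also have "\<dots> = (\<Sum>(u,t)\<in>elem_index w c. op_scale (?f u t) (elem_op w c (u, t))) \<xi> i"
    unfolding sum_op_apply by (simp add: case_prod_unfold)
  finally show "a \<xi> i = (\<Sum>(u,t)\<in>elem_index w c. op_scale (?f u t) (elem_op w c (u, t))) \<xi> i" .
qed

lemma span_elem_op:
  fixes w :: "int \<Rightarrow> 'l::finite"
  shows "op.span (elem_op w c ` elem_index w c) = (local_ops w c :: 'k::field operator set)"
proof
  show "op.span (elem_op w c ` elem_index w c) \<subseteq> (local_ops w c :: 'k operator set)"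
    using elem_op_local_ops by (intro op.span_minimal subspace_local_ops) auto
  show "local_ops w c \<subseteq> op.span (elem_op w c ` elem_index w c :: 'k operator set)"
  proof
    fix a :: "'k operator" assume "a \<in> local_ops w c"
    from local_ops_expansion[OF this] show "a \<in> op.span (elem_op w c ` elem_index w c)"
      by (rule ssubst) (intro op.span_sum, auto intro: op.span_scale op.span_base)
  qed
qed

text \<open>
  Multiplied by a shift, the given element has a nonzero diagonal entry at some \<open>i\<close>. Its compression
  by the projection onto the occurrences of a long enough window at \<open>i\<close> is a scalar multiple of that
  projection: within the radius of the operator there is no second occurrence, and the diagonal entries at all
  occurrences are equal by locality.
\<close>

lemma local_alg_ideal_contains_id:
  fixes w :: "int \<Rightarrow> 'l" and J :: "'k::field operator set"
  assumes recurrent: "\<And>i c. \<exists>R. \<forall>j. \<exists>s<R. agree w c i (j + int s)"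
    and aperiodic: "\<And>n. n \<noteq> 0 \<Longrightarrow> \<exists>i. w (i + n) \<noteq> w i"
    and sub: "op.subspace J"
    and left: "\<And>a x. a \<in> local_alg w \<Longrightarrow> x \<in> J \<Longrightarrow> a \<circ> x \<in> J"
    and right: "\<And>a x. a \<in> local_alg w \<Longrightarrow> x \<in> J \<Longrightarrow> x \<circ> a \<in> J"
    and x: "x \<in> J" "x \<in> local_alg w" "x \<noteq> 0"
  shows "id \<in> J"
proof -
  have loc: "a \<in> local_alg w" if "a \<in> local_ops w c" for a :: "'k operator" and c
    using that by (auto simp: local_alg_def)
  obtain c0 where c0: "x \<in> local_ops w c0" using x(2) by (auto simp: local_alg_def)
  obtain u t i where uti: "x (point_mass (i + t)) i \<noteq> 0"
  proof (rule ccontr)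
    assume "\<not> thesis"
    then have z: "x (point_mass (i + t)) i = 0" for i t using that by blast
    have "x \<xi> i = 0" for \<xi> i
      by (simp add: local_ops_point_expansion[OF c0, of \<xi>] z)
    then have "x = 0" by (auto simp: fun_eq_iff)
    with x(3) show False by simp
  qed
  define y where "y = x \<circ> shift (- t)"
  have st: "shift (- t) \<in> local_ops w (nat \<bar>t\<bar>)" by (intro shift_local_ops) simp
  have yJ: "y \<in> J" unfolding y_def using right[OF loc[OF st] x(1)] .
  define c where "c = c0 + nat \<bar>t\<bar>"
  have yc: "y \<in> local_ops w c" unfolding y_def c_def by (rule local_ops_comp[OF c0 st])
  have "shift (- t) (point_mass i) = (point_mass (i + t) :: int \<Rightarrow> 'k)" by (auto simp: fun_eq_iff shift_def point_mass_def)
  with uti have y0: "y (point_mass i) i \<noteq> 0" by (simp add: y_def)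
  \<comment> \<open>For each displacement \<open>n\<close> some \<open>s n\<close> witnesses that \<open>n\<close> is not a period.  If the window
    covers all these witnesses, two occurrences cannot differ by \<open>n\<close>.\<close>
  obtain L where L: "L \<ge> c"
    "\<And>j n. j \<in> occ w L i \<Longrightarrow> j + n \<in> occ w L i \<Longrightarrow> \<bar>n\<bar> \<le> int c \<Longrightarrow> n = 0"
  proof -
    have "\<forall>n. \<exists>s. n \<noteq> 0 \<longrightarrow> w (i + s + n) \<noteq> w (i + s)"
      using aperiodic by (metis add.commute add_diff_cancel_left' diff_add_cancel)
    then obtain s where s: "\<And>n. n \<noteq> 0 \<Longrightarrow> w (i + s n + n) \<noteq> w (i + s n)" by metis
    define L where "L = c + Max (insert 0 ((\<lambda>n. nat \<bar>s n\<bar>) ` {- int c..int c}))"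
    have sL: "\<bar>s n\<bar> + int c \<le> int L" if "\<bar>n\<bar> \<le> int c" for n
    proof -
      have "nat \<bar>s n\<bar> \<le> Max (insert 0 ((\<lambda>n. nat \<bar>s n\<bar>) ` {- int c..int c}))"
        using that by (intro Max_ge) (auto intro!: imageI)
      then show ?thesis by (simp add: L_def)
    qed
    have "n = 0" if j: "j \<in> occ w L i" "j + n \<in> occ w L i" and n: "\<bar>n\<bar> \<le> int c" for j n
    proof (rule ccontr)
      assume "n \<noteq> 0"
      have "\<bar>s n\<bar> \<le> int L" "\<bar>n + s n\<bar> \<le> int L" using sL[OF n] n by linarith+
      then have "w (i + s n) = w (j + n + s n)" "w (i + (n + s n)) = w (j + (n + s n))"
        using j by (auto simp: occ_def agree_def)
      then have "w (i + s n + n) = w (i + s n)" by (simp add: algebra_simps)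
      with s[OF \<open>n \<noteq> 0\<close>] show False by simp
    qed
    moreover have "L \<ge> c" by (simp add: L_def)
    ultimately show thesis using that by blast
  qed
  define P where "P = (restrict_to (occ w L i) :: 'k operator)"
  have Ploc: "P \<in> local_alg w" unfolding P_def using restrict_occ_local_ops by (rule loc)
  have "P \<circ> y \<circ> P \<in> J" using left[OF Ploc] right[OF Ploc] yJ by (simp add: comp_assoc)
  moreover have "P \<circ> y \<circ> P = op_scale (y (point_mass i) i) P"
  proof (intro ext)
    fix \<xi> j
    show "(P \<circ> y \<circ> P) \<xi> j = op_scale (y (point_mass i) i) P \<xi> j"
    proof (cases "j \<in> occ w L i")
      case True
      have "y (P \<xi>) j = y (\<lambda>l. \<xi> j * point_mass i l) i"
      proof (rule local_opsD(3)[OF yc])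
        show "agree w c j i" using True L(1) by (auto simp: occ_def intro: agree_sym agree_mono)
        fix t assume "\<bar>t\<bar> \<le> int c"
        then show "P \<xi> (j + t) = \<xi> j * point_mass i (i + t)"
          using L(2)[OF True, of t] True by (auto simp: P_def restrict_to_def point_mass_def)
      qed
      also have "\<dots> = \<xi> j * y (point_mass i) i" by (simp add: local_opsD(2)[OF yc])
      finally show ?thesis using True by (simp add: P_def restrict_to_def op_scale_def)
    qed (simp add: P_def restrict_to_def op_scale_def)
  qed
  ultimately have "op_scale (inverse (y (point_mass i) i)) (op_scale (y (point_mass i) i) P) \<in> J"
    using op.subspace_scale[OF sub] by metis
  then have PJ: "P \<in> J" using y0 by simp
  obtain R where R: "\<And>j. \<exists>s<R. agree w L i (j + int s)" using recurrent by blast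
  \<comment> \<open>The projections onto unions of translates of the occurrences lie in the ideal, and some finite union is everything.\<close>
  define U where "U m = (restrict_to {j. \<exists>s<m. agree w L i (j + int s)} :: 'k operator)" for m :: nat
  define Q where "Q s = shift (int s) \<circ> P \<circ> shift (- int s)" for s :: nat
  have Qeq: "Q s = restrict_to {j. agree w L i (j + int s)}" for s
    unfolding Q_def P_def shift_restrict_to by (simp add: occ_def)
  have sh: "(shift n :: 'k operator) \<in> local_alg w" for n
    by (rule loc[OF shift_local_ops[of n "nat \<bar>n\<bar>"]]) simp
  have QJ: "Q s \<in> J" and Qloc: "Q s \<in> local_alg w" for s
  proof -
    show "Q s \<in> J" unfolding Q_def using left[OF sh] right[OF sh] PJ by blast
    have "Q s \<in> local_ops w (nat \<bar>int s\<bar> + L + nat \<bar>- int s\<bar>)"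
      unfolding Q_def P_def by (intro local_ops_comp shift_local_ops restrict_occ_local_ops) auto
    then show "Q s \<in> local_alg w" by (rule loc)
  qed
  have "U m \<in> J" for m
  proof (induction m)
    case 0
    have "U 0 = 0" by (auto simp: U_def fun_eq_iff restrict_to_def)
    then show ?case using op.subspace_0[OF sub] by metis
  next
    case (Suc m)
    have "{j. \<exists>s<Suc m. agree w L i (j + int s)}
        = {j. \<exists>s<m. agree w L i (j + int s)} \<union> {j. agree w L i (j + int m)}"
      by (auto simp: less_Suc_eq)
    then have "U (Suc m) = U m + Q m - (Q m \<circ> U m)"
      unfolding Qeq U_def by (simp only: restrict_to_Un)
    moreover have "U m + Q m \<in> J" using op.subspace_add[OF sub Suc QJ] .
    moreover have "Q m \<circ> U m \<in> J" using left[OF Qloc Suc] .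
    ultimately show ?case using op.subspace_diff[OF sub] by metis
  qed
  moreover have "U R = id"
  proof -
    have "{j. \<exists>s<R. agree w L i (j + int s)} = UNIV" using R by blast
    then show ?thesis by (simp add: U_def fun_eq_iff restrict_to_def)
  qed
  ultimately show ?thesis by metis
qed

section \<open>The algebra of local operators in coordinates\<close>

lemma poly_mapping_coordinates:
  fixes sB :: "'k::field \<Rightarrow> 'b::ab_group_add \<Rightarrow> 'b" and B :: "'b set"
  assumes vs: "vector_space sB" and ind: "\<not> module.dependent sB B" and b: "bij_betw b (UNIV :: nat set) B"
  obtains \<phi> :: "'k countable_space \<Rightarrow> 'b"
  where "\<And>x y. \<phi> (x + y) = \<phi> x + \<phi> y" and "inj \<phi>" and "range \<phi> = module.span sB B"
proof -
  interpret vector_space sB by (rule vs)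
  define \<phi> where "\<phi> x = (\<Sum>n\<in>Poly_Mapping.keys x. sB (Poly_Mapping.lookup x n) (b n))"
    for x :: "'k countable_space"
  have \<phi>: "\<phi> x = (\<Sum>n\<in>K. sB (Poly_Mapping.lookup x n) (b n))"
    if "finite K" "Poly_Mapping.keys x \<subseteq> K" for x K
    unfolding \<phi>_def using that by (intro sum.mono_neutral_left) (auto simp: in_keys_iff)
  have add: "\<phi> (x + y) = \<phi> x + \<phi> y" for x y
  proof -
    let ?K = "Poly_Mapping.keys x \<union> Poly_Mapping.keys y"
    have "Poly_Mapping.keys (x + y) \<subseteq> ?K" by (rule Poly_Mapping.keys_add)
    then show ?thesis
      by (simp add: \<phi>[of ?K "x + y"] \<phi>[of ?K x] \<phi>[of ?K y] lookup_add scale_left_distrib sum.distrib)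
  qed
  have inj_b: "inj b" and ran_b: "range b = B" using b by (auto simp: bij_betw_def)
  have zero: "x = 0" if "\<phi> x = 0" for x
  proof (rule poly_mapping_eqI)
    fix n
    show "Poly_Mapping.lookup x n = Poly_Mapping.lookup 0 n"
    proof (cases "n \<in> Poly_Mapping.keys x")
      case True
      let ?K = "Poly_Mapping.keys x"
      have inj: "inj_on b ?K" using inj_b by (rule inj_on_subset) simp
      have "(\<Sum>v\<in>b ` ?K. sB (Poly_Mapping.lookup x (inv b v)) v) = 0"
        using that by (simp add: sum.reindex[OF inj] \<phi>_def inv_f_f[OF inj_b])
      then have "Poly_Mapping.lookup x (inv b (b n)) = 0"
        using independentD[OF ind, of "b ` ?K" "\<lambda>v. Poly_Mapping.lookup x (inv b v)" "b n"] True ran_b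
        by auto
      then show ?thesis by (simp add: inv_f_f[OF inj_b])
    qed (simp add: in_keys_iff)
  qed
  moreover have "inj \<phi>"
  proof (rule injI)
    fix x y assume "\<phi> x = \<phi> y"
    then have "\<phi> (x - y) = 0" using add[of "x - y" y] by simp
    then show "x = y" using zero by force
  qed
  moreover have "range \<phi> = span B"
  proof
    show "range \<phi> \<subseteq> span B" 
      unfolding \<phi>_def using ran_b by (intro image_subsetI span_sum span_scale span_base) auto
    show "span B \<subseteq> range \<phi>"
    proof
      fix v assume "v \<in> span B"
      then show "v \<in> range \<phi>"
      proof (induction rule: span_induct_alt)
        case base
        have "\<phi> 0 = 0" by (simp add: \<phi>_def)
        then show ?case by (metis rangeI)
      next
        case (step c a v)
        obtain n where n: "a = b n" using step(1) ran_b by blast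
        obtain x where x: "v = \<phi> x" using step(2) by blast
        have "\<phi> (Poly_Mapping.single n c) = sB c a" by (subst \<phi>[of "{n}"]) (auto simp: n)
        then have "sB c a + v = \<phi> (Poly_Mapping.single n c + x)" by (simp add: add x)
        then show ?case by (metis rangeI)
      qed
    qed
  qed
  ultimately show thesis using add by (intro that)
qed

lemma subspace_local_alg: "op.subspace (local_alg w)"
  unfolding op.subspace_def
proof (intro conjI ballI allI)
  show "0 \<in> local_alg w" unfolding local_alg_def using op.subspace_0[OF subspace_local_ops] by blast
next
  fix a b :: "'a operator" assume "a \<in> local_alg w" "b \<in> local_alg w"
  then obtain m n where "a \<in> local_ops w m" "b \<in> local_ops w n" by (auto simp: local_alg_def)
  then have "a \<in> local_ops w (max m n)" "b \<in> local_ops w (max m n)"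
    using local_ops_mono[of m "max m n" w] local_ops_mono[of n "max m n" w] by auto
  then have "a + b \<in> local_ops w (max m n)" by (rule op.subspace_add[OF subspace_local_ops])
  then show "a + b \<in> local_alg w" by (auto simp: local_alg_def)
next
  fix k and a :: "'a operator" assume "a \<in> local_alg w"
  then obtain m where "a \<in> local_ops w m" by (auto simp: local_alg_def)
  then have "op_scale k a \<in> local_ops w m" by (rule op.subspace_scale[OF subspace_local_ops])
  then show "op_scale k a \<in> local_alg w" by (auto simp: local_alg_def)
qed

lemma local_alg_comp: "a \<in> local_alg w \<Longrightarrow> b \<in> local_alg w \<Longrightarrow> a \<circ> b \<in> local_alg w"
proof -
  assume "a \<in> local_alg w" "b \<in> local_alg w"
  then obtain m n where "a \<in> local_ops w m" "b \<in> local_ops w n" by (auto simp: local_alg_def)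
  then have "a \<circ> b \<in> local_ops w (m + n)" by (rule local_ops_comp)
  then show ?thesis by (auto simp: local_alg_def)
qed

lemma local_alg_add: "a \<in> local_alg w \<Longrightarrow> a (\<xi> + \<eta>) = a \<xi> + a \<eta>"
  by (auto simp: local_alg_def local_opsD(1))

lemma local_alg_scale: "a \<in> local_alg w \<Longrightarrow> a (\<lambda>j. k * \<xi> j) = (\<lambda>j. k * a \<xi> j)"
  by (auto simp: local_alg_def local_opsD(2))

text \<open>
  Any basis works: it meets each finite-dimensional layer in a finite set, so it is countable, and the dimensions
  of the layers are unbounded.
\<close>

lemma local_alg_basis:
  fixes w :: "int \<Rightarrow> 'l::finite"
  obtains B :: "'k::field operator set" and b :: "nat \<Rightarrow> 'k operator"
  where "op.independent B" "op.span B = local_alg w" "bij_betw b UNIV B"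
proof -
  obtain B :: "'k operator set" where B: "B \<subseteq> local_alg w" "op.independent B" "local_alg w \<subseteq> op.span B"
    using op.maximal_independent_subset by blast
  have fin: "finite (B \<inter> local_ops w c)" for c
  proof -
    have "op.independent (B \<inter> local_ops w c)" using B(2) by (rule op.independent_mono) simp
    then show ?thesis
      using op.independent_span_bound[OF finite_imageI[OF finite_elem_index], of "B \<inter> local_ops w c" "elem_op w c" w c]
      by (auto simp: span_elem_op)
  qed
  have "B = (\<Union>c. B \<inter> local_ops w c)" using B(1) by (auto simp: local_alg_def)
  moreover have "countable (\<Union>c. B \<inter> local_ops w c)"
    by (rule countable_UN[OF countableI_type countable_finite[OF fin]])
  ultimately have cnt: "countable B" by (simp only:)
  have "infinite B"
  proof
    assume fin: "finite B"
    define c where "c = card B"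
    have "elem_op w c ` elem_index w c \<subseteq> op.span B"
    proof (intro image_subsetI)
      fix p assume "p \<in> elem_index w c"
      then have "elem_op w c p \<in> local_ops w c" by (rule elem_op_local_ops)
      then show "elem_op w c p \<in> op.span B" using B(3) by (auto simp: local_alg_def)
    qed
    then have "card (elem_op w c ` elem_index w c :: 'k operator set) \<le> card B"
      using op.independent_span_bound[OF fin independent_elem_op] by blast
    then have "(2 * c + 1) * complexity w c \<le> c"
      by (simp only: card_image[OF inj_elem_op] card_elem_index c_def)
    moreover have "complexity w c > 0"
      unfolding complexity_def using finite_range_window by (simp add: card_gt_0_iff)
    then have "(2 * c + 1) * 1 \<le> (2 * c + 1) * complexity w c" by (intro mult_le_mono2) simp
    ultimately have "(2 * c + 1) * 1 \<le> c" by (rule order_trans[rotated])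
    then show False by simp
  qed
  with cnt obtain b :: "nat \<Rightarrow> 'k operator" where "bij_betw b UNIV B"
    using bij_betw_from_nat_into by blast
  moreover have "op.span B = local_alg w"
    using B by (intro antisym op.span_minimal subspace_local_alg)
  ultimately show ?thesis using B(2) that by blast
qed

definition generators :: "(int \<Rightarrow> 'l::finite) \<Rightarrow> 'k::field operator set" where
  "generators w = {id, shift 1, shift (- 1)} \<union> range (\<lambda>l. restrict_to {i. w i = l})"

lemma finite_generators: "finite (generators (w :: int \<Rightarrow> 'l::finite))"
  by (simp add: generators_def)

lemma generators_local: "generators w \<subseteq> local_ops w 1"
proof -
  have "id \<in> local_ops w 1" using id_local_ops local_ops_mono[of 0 1 w] by auto
  moreover have "restrict_to {i. w i = l} \<in> local_ops w 1" for l
  proof (rule restrict_to_local_ops)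
    fix i j assume "agree w 1 i j"
    then have "w (i + 0) = w (j + 0)" unfolding agree_def by (metis abs_zero of_nat_0_le_iff)
    then show "i \<in> {i. w i = l} \<longleftrightarrow> j \<in> {i. w i = l}" by simp
  qed
  ultimately show ?thesis by (auto simp: generators_def intro: shift_local_ops)
qed

text \<open>
  Here \<open>G n\<close> stands for the words of length \<open>n\<close> in the generators. The projection onto
  the occurrences of a word is obtained letter by letter, conjugating by one shift after each letter; this uses
  three generators per letter. A final conjugation centres the window, and the displacement \<open>t\<close> costs
  another \<open>c\<close> shifts, so that \<open>9 * c + 3\<close> generators suffice.
\<close>

lemma local_ops_word_length:
  fixes w :: "int \<Rightarrow> 'l::finite" and G :: "nat \<Rightarrow> 'k::field operator set"
  assumes sub: "\<And>n. op.subspace (G n)"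
    and gen: "generators w \<subseteq> G 1" and unit: "id \<in> G 0"
    and comp: "\<And>a b m n. a \<in> G m \<Longrightarrow> b \<in> G n \<Longrightarrow> a \<circ> b \<in> G (m + n)"
    and mono: "\<And>m n. m \<le> n \<Longrightarrow> G m \<subseteq> G n"
  shows "local_ops w c \<subseteq> G (9 * Suc c)"
proof -
  have sh1: "shift 1 \<in> G 1" and shm1: "shift (- 1) \<in> G 1" using gen by (auto simp: generators_def)
  have sh: "shift t \<in> G (nat \<bar>t\<bar>)" for t
  proof -
    have p: "shift (int n) \<in> G n" for n
    proof (induction n)
      case 0 show ?case using unit by (simp only: shift_0 of_nat_0 minus_zero)
    next
      case (Suc n)
      from comp[OF sh1 Suc] show ?case by (simp add: shift_shift)
    qed
    have m: "shift (- int n) \<in> G n" for n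
    proof (induction n)
      case 0 show ?case using unit by (simp only: shift_0 of_nat_0 minus_zero)
    next
      case (Suc n)
      from comp[OF shm1 Suc] show ?case by (simp add: shift_shift)
    qed
    show ?thesis using p[of "nat \<bar>t\<bar>"] m[of "nat \<bar>t\<bar>"] by (cases "t \<ge> 0") auto
  qed
  have forward: "restrict_to {j. \<forall>s<n. w (j + int s) = w (i + int s)} \<in> G (3 * n)" for n i
  proof (induction n arbitrary: i)
    case 0
    have "(restrict_to {j. \<forall>s<0. w (j + int s) = w (i + int s)} :: 'k operator) = id"
      by (auto simp: fun_eq_iff restrict_to_def)
    then show ?case using unit by (simp only: mult_0_right)
  next
    case (Suc n)
    let ?X = "\<lambda>i n. {j. \<forall>s<n. w (j + int s) = w (i + int s)}"
    have "restrict_to {j. w j = w i} \<in> G 1" using gen by (auto simp: generators_def)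
    from comp[OF this comp[OF comp[OF sh1 Suc] shm1]]
    have "restrict_to {j. w j = w i} \<circ> (shift 1 \<circ> restrict_to (?X (i + 1) n) \<circ> shift (- 1)) \<in> G (1 + (1 + 3 * n + 1))" .
    also have "restrict_to {j. w j = w i} \<circ> (shift 1 \<circ> restrict_to (?X (i + 1) n) \<circ> shift (- 1))
        = (restrict_to ({j. w j = w i} \<inter> {j. j + 1 \<in> ?X (i + 1) n}) :: 'k operator)"
      by (simp only: shift_restrict_to restrict_to_Int)
    also have "{j. w j = w i} \<inter> {j. j + 1 \<in> ?X (i + 1) n} = ?X i (Suc n)"
    proof -
      have "(\<forall>s<Suc n. w (j + int s) = w (i + int s)) \<longleftrightarrow>
          w j = w i \<and> (\<forall>s<n. w (j + 1 + int s) = w (i + 1 + int s))" for j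
        unfolding less_Suc_eq_0_disj by (auto simp: add.assoc)
      then show ?thesis by auto
    qed
    finally have "restrict_to (?X i (Suc n)) \<in> G (1 + (1 + 3 * n + 1))" .
    moreover have "1 + (1 + 3 * n + 1) = 3 * Suc n" by simp
    ultimately show ?case by (simp only:)
  qed
  have "elem_op w c p \<in> G (9 * Suc c)" if p0: "p \<in> elem_index w c" for p
  proof -
    obtain i t where p: "p = (window w c i, t)" "\<bar>t\<bar> \<le> int c"
      using p0 unfolding elem_index_def by auto
    let ?X = "{j. \<forall>s<2 * c + 1. w (j + int s) = w (i - int c + int s)}"
    have "shift (- int c) \<in> G c" "shift (- (- int c)) \<in> G c"
      using sh[of "- int c"] sh[of "int c"] by (simp_all only: abs_minus_cancel minus_minus abs_of_nat nat_int)
    from comp[OF comp[OF comp[OF this(1) forward] this(2)] sh]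
    have "shift (- int c) \<circ> restrict_to ?X \<circ> shift (- (- int c)) \<circ> shift t \<in> G (c + 3 * (2 * c + 1) + c + nat \<bar>t\<bar>)" .
    also have "shift (- int c) \<circ> restrict_to ?X \<circ> shift (- (- int c)) = (restrict_to {j. j + - int c \<in> ?X} :: 'k operator)"
      by (rule shift_restrict_to)
    also have "{j. j + - int c \<in> ?X} = {j. window w c j = window w c i}"
    proof -
      have "(\<forall>s<2 * c + 1. w (j - int c + int s) = w (i - int c + int s)) \<longleftrightarrow> agree w c j i" for j
        unfolding agree_def
      proof (intro iffI allI impI)
        fix t assume *: "\<forall>s<2 * c + 1. w (j - int c + int s) = w (i - int c + int s)" and "\<bar>t\<bar> \<le> int c"
        then have "nat (t + int c) < 2 * c + 1" "int (nat (t + int c)) = t + int c" by auto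
        with * show "w (j + t) = w (i + t)" by fastforce
      next
        fix s assume *: "\<forall>t. \<bar>t\<bar> \<le> int c \<longrightarrow> w (j + t) = w (i + t)" and "s < 2 * c + 1"
        then have "\<bar>int s - int c\<bar> \<le> int c" by auto
        with * have "w (j + (int s - int c)) = w (i + (int s - int c))" by blast
        then show "w (j - int c + int s) = w (i - int c + int s)" by (simp add: algebra_simps)
      qed
      then show ?thesis by (auto simp: window_eq_iff)
    qed
    also have "restrict_to {j. window w c j = window w c i} \<circ> shift t = (elem_op w c p :: 'k operator)"
      by (simp add: elem_op_def p(1))
    finally have "elem_op w c p \<in> G (c + 3 * (2 * c + 1) + c + nat \<bar>t\<bar>)" .
    moreover have "c + 3 * (2 * c + 1) + c + nat \<bar>t\<bar> \<le> 9 * Suc c" using p(2) by simp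
    ultimately show ?thesis using mono by blast
  qed
  then have "op.span (elem_op w c ` elem_index w c) \<subseteq> G (9 * Suc c)"
    by (intro op.span_minimal sub) auto
  then show ?thesis by (simp only: span_elem_op)
qed

text \<open>
  The operators are transported along the coordinates \<open>\<phi>\<close>; every property is checked after
  applying \<open>\<phi>\<close>.
\<close>

lemma simple_local_algebra:
  fixes w :: "int \<Rightarrow> 'l::finite"
  assumes recurrent: "\<And>i c. \<exists>R. \<forall>j. \<exists>s<R. agree w c i (j + int s)"
    and aperiodic: "\<And>n. n \<noteq> 0 \<Longrightarrow> \<exists>i. w (i + n) \<noteq> w i"
  obtains scale :: "'k::field \<Rightarrow> 'k countable_space \<Rightarrow> 'k countable_space" and mult unit F S0
  where "filtered_algebra scale mult unit F (\<lambda>c. (2 * c + 1) * complexity w c) S0 9"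
    and "unital_algebra.simple_algebra scale mult"
proof -
  obtain B :: "'k operator set" and b :: "nat \<Rightarrow> 'k operator"
    where B: "op.independent B" "op.span B = local_alg w" "bij_betw b UNIV B"
    using local_alg_basis by blast
  obtain \<phi> :: "'k countable_space \<Rightarrow> 'k operator"
    where add: "\<And>x y. \<phi> (x + y) = \<phi> x + \<phi> y" and inj: "inj \<phi>" and "range \<phi> = op.span B"
    using poly_mapping_coordinates[OF op.vector_space_axioms B(1,3)] by blast
  have ran: "range \<phi> = local_alg w" using \<open>range \<phi> = op.span B\<close> B(2) by simp
  define \<psi> where "\<psi> = inv \<phi>"
  have \<phi>\<psi>: "\<phi> (\<psi> a) = a" if "a \<in> local_alg w" for a
    unfolding \<psi>_def using that ran by (metis f_inv_into_f)
  have loc: "\<phi> x \<in> local_alg w" for x using ran by blast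
  have eqI: "x = y" if "\<phi> x = \<phi> y" for x y using inj that by (rule injD)
  define scale where "scale c x = \<psi> (op_scale c (\<phi> x))" for c x
  define mult where "mult x y = \<psi> (\<phi> x \<circ> \<phi> y)" for x y
  define unit where "unit = \<psi> id"
  have sc: "\<phi> (scale c x) = op_scale c (\<phi> x)" for c x
    unfolding scale_def by (rule \<phi>\<psi>) (rule op.subspace_scale[OF subspace_local_alg loc])
  have mu: "\<phi> (mult x y) = \<phi> x \<circ> \<phi> y" for x y
    unfolding mult_def by (rule \<phi>\<psi>) (rule local_alg_comp[OF loc loc])
  have un: "\<phi> unit = id"
    unfolding unit_def by (rule \<phi>\<psi>) (use id_local_ops in \<open>auto simp: local_alg_def\<close>)
  have z: "\<phi> 0 = 0" using add[of 0 0] by simp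
  interpret A: unital_algebra scale mult unit
  proof
    fix a b x y z c
    show "scale a (x + y) = scale a x + scale a y"
      by (rule eqI) (simp add: sc add op.scale_right_distrib)
    show "scale (a + b) x = scale a x + scale b x"
      by (rule eqI) (simp add: sc add op.scale_left_distrib)
    show "scale a (scale b x) = scale (a * b) x" by (rule eqI) (simp add: sc)
    show "scale 1 x = x" by (rule eqI) (simp add: sc)
    show "mult (mult x y) z = mult x (mult y z)" by (rule eqI) (simp only: mu comp_assoc)
    show "mult (x + y) z = mult x z + mult y z"
      by (rule eqI) (simp only: mu add, simp add: fun_eq_iff)
    show "mult x (y + z) = mult x y + mult x z"
      by (rule eqI) (simp only: mu add, simp add: fun_eq_iff local_alg_add[OF loc])
    show "mult (scale c x) y = scale c (mult x y)"
      by (rule eqI) (simp only: mu sc, simp add: fun_eq_iff op_scale_def)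
    show "mult x (scale c y) = scale c (mult x y)"
      by (rule eqI) (simp only: mu sc, simp add: fun_eq_iff op_scale_def local_alg_scale[OF loc])
    show "mult unit x = x" by (rule eqI) (simp only: mu un id_comp)
    show "mult x unit = x" by (rule eqI) (simp only: mu un comp_id)
  qed
  interpret \<phi>: module_hom scale op_scale \<phi>
    by unfold_locales (simp_all add: add sc)
  define F where "F c = {x. \<phi> x \<in> local_ops w c}" for c
  define S0 where "S0 = \<psi> ` generators w"
  have \<phi>S0: "\<phi> (\<psi> a) = a" if "a \<in> local_ops w c" for a c
    using that by (intro \<phi>\<psi>) (auto simp: local_alg_def)
  have nonzero: "unit \<noteq> 0"
  proof
    assume "unit = 0"
    then have "(id :: 'k operator) = 0" using un z by simp
    then have "(id :: 'k operator) (\<lambda>_. 1) 0 = 0" by (metis zero_fun_apply)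
    then show False by simp
  qed
  have uS0: "unit \<in> S0" by (simp add: unit_def S0_def generators_def)
  have filt: "filtered_algebra scale mult unit F (\<lambda>c. (2 * c + 1) * complexity w c) S0 9"
  proof
    fix c :: nat
    show "A.subspace (F c)"
      unfolding F_def by (rule \<phi>.subspace_linear_preimage) (rule subspace_local_ops)
    show "unit \<in> F 0" by (simp add: F_def un id_local_ops)
    show "mult x y \<in> F (m + n)" if "x \<in> F m" "y \<in> F n" for x y m n
      using that local_ops_comp by (auto simp: F_def mu)
    show "F m \<subseteq> F n" if "m \<le> n" for m n
      using local_ops_mono[OF that] by (auto simp: F_def)
    show "\<exists>c. x \<in> F c" for x using loc[of x] by (auto simp: F_def local_alg_def)
    show "\<exists>D. finite D \<and> A.independent D \<and> A.span D = F c \<and> card D = (2 * c + 1) * complexity w c"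
    proof -
      let ?E = "elem_op w c ` elem_index w c :: 'k operator set"
      define D where "D = \<psi> ` ?E"
      have \<phi>E: "\<phi> (\<psi> a) = a" if "a \<in> ?E" for a
        using that elem_op_local_ops by (intro \<phi>S0[of _ c]) auto
      have "(\<lambda>a. \<phi> (\<psi> a)) ` ?E = (\<lambda>a. a) ` ?E" by (rule image_cong[OF refl \<phi>E])
      then have \<phi>D: "\<phi> ` D = ?E" unfolding D_def image_image by simp
      have card: "card D = card ?E"
        using card_image[of \<phi> D] inj_on_subset[OF inj subset_UNIV[of D]] \<phi>D by simp
      have "card ?E = (2 * c + 1) * complexity w c"
        by (simp only: card_image[OF inj_elem_op] card_elem_index)
      moreover have "finite D" unfolding D_def by (intro finite_imageI finite_elem_index)
      moreover have "A.independent D"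
      proof
        assume "A.dependent D"
        then obtain x where x: "x \<in> D" "x \<in> A.span (D - {x})" unfolding A.dependent_def by blast
        then have "\<phi> x \<in> op.span (\<phi> ` (D - {x}))" by (simp add: \<phi>.span_image)
        moreover have "\<phi> ` (D - {x}) = ?E - {\<phi> x}" using \<phi>D inj by (auto simp: inj_eq)
        ultimately have "\<phi> x \<in> op.span (?E - {\<phi> x})" by (simp only:)
        moreover have "\<phi> x \<in> ?E" using x(1) \<phi>D by blast
        ultimately have "op.dependent ?E" unfolding op.dependent_def by (rule rev_bexI[rotated])
        then show False using independent_elem_op by blast
      qed
      moreover have "A.span D = F c"
      proof -
        have "\<phi> ` A.span D = local_ops w c" by (simp only: \<phi>.span_image[symmetric] \<phi>D span_elem_op)
        then have "\<phi> x \<in> local_ops w c \<longleftrightarrow> x \<in> A.span D" for x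
          using inj_image_mem_iff[OF inj, of x "A.span D"] by (simp only:)
        then show ?thesis unfolding F_def by auto
      qed
      ultimately show ?thesis using card by auto
    qed
    show "unit \<noteq> 0" by (rule nonzero)
    show "finite S0" unfolding S0_def by (intro finite_imageI finite_generators)
    show "unit \<in> S0" by (rule uS0)
    show "F c \<subseteq> A.space_power (A.span S0) (9 * Suc c)"
    proof -
      define G where "G n = \<phi> ` A.space_power (A.span S0) n" for n
      have uV: "unit \<in> A.span S0" using uS0 by (rule A.span_base)
      have "local_ops w c \<subseteq> G (9 * Suc c)"
      proof (rule local_ops_word_length)
        show "op.subspace (G n)" for n
          unfolding G_def A.space_power_def by (rule \<phi>.subspace_image[OF A.subspace_span])
        show "(generators w :: 'k operator set) \<subseteq> G 1"
        proof
          fix a :: "'k operator" assume a: "a \<in> generators w"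
          have "\<psi> a \<in> A.space_power (A.span S0) 1"
            using a by (intro A.in_space_power_one A.span_base) (simp add: S0_def)
          moreover have "\<phi> (\<psi> a) = a" using a generators_local[of w] by (intro \<phi>S0[of _ 1]) auto
          ultimately show "a \<in> G 1" unfolding G_def by (metis imageI)
        qed
        show "id \<in> G 0"
          using A.unit_in_space_power[OF uV, of 0] un unfolding G_def by (metis imageI)
        show "a \<circ> b \<in> G (m + n)" if ab: "a \<in> G m" "b \<in> G n" for a b m n
        proof -
          obtain x y where xy: "a = \<phi> x" "x \<in> A.space_power (A.span S0) m"
            "b = \<phi> y" "y \<in> A.space_power (A.span S0) n" using ab unfolding G_def by blast
          have "mult x y \<in> A.space_power (A.span S0) (m + n)" using xy(2,4) by (rule A.space_power_mult)
          then have "\<phi> (mult x y) \<in> G (m + n)" unfolding G_def by (rule imageI)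
          then show ?thesis by (simp only: mu xy(1,3))
        qed
        show "G m \<subseteq> G n" if "m \<le> n" for m n
          unfolding G_def using A.space_power_mono[OF uV that] by (rule image_mono)
      qed
      then have "\<phi> x \<in> \<phi> ` A.space_power (A.span S0) (9 * Suc c)" if "x \<in> F c" for x
        using that unfolding F_def G_def by blast
      then show ?thesis using inj_image_mem_iff[OF inj] by blast
    qed
  qed
  have "A.simple_algebra"
    unfolding A.simple_algebra_def
  proof (intro conjI allI impI)
    show "(UNIV :: 'k countable_space set) \<noteq> {0}" using nonzero by blast
    fix I assume I: "A.two_sided_ideal I"
    then have sub: "A.subspace I" and ideal: "\<And>a x. x \<in> I \<Longrightarrow> mult a x \<in> I \<and> mult x a \<in> I"
      unfolding A.two_sided_ideal_def by auto
    show "I = {0} \<or> I = UNIV"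
    proof (cases "\<exists>x\<in>I. x \<noteq> 0")
      case False
      then show ?thesis using A.subspace_0[OF sub] by auto
    next
      case True
      then obtain x where x: "x \<in> I" "x \<noteq> 0" by blast
      have "id \<in> \<phi> ` I"
      proof (rule local_alg_ideal_contains_id[OF recurrent aperiodic])
        show "op.subspace (\<phi> ` I)" by (rule \<phi>.subspace_image[OF sub])
        show "a \<circ> y \<in> \<phi> ` I" and "y \<circ> a \<in> \<phi> ` I" if a: "a \<in> local_alg w" and y: "y \<in> \<phi> ` I" for a y
        proof -
          obtain u where u: "y = \<phi> u" "u \<in> I" using y by blast
          have "a \<circ> y = \<phi> (mult (\<psi> a) u)" "y \<circ> a = \<phi> (mult u (\<psi> a))"
            using u \<phi>\<psi>[OF a] by (simp_all only: mu)
          then show "a \<circ> y \<in> \<phi> ` I" "y \<circ> a \<in> \<phi> ` I" using ideal[OF u(2)] by auto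
        qed
        show "\<phi> x \<in> \<phi> ` I" using x by blast
        show "\<phi> x \<in> local_alg w" by (rule loc)
        show "\<phi> x \<noteq> 0" using x(2) eqI[of x 0] z by auto
      qed
      then have "unit \<in> I" using un inj by (metis inj_image_mem_iff)
      then have "a \<in> I" for a using ideal[of unit a] by (simp add: A.mult_unit_right)
      then show ?thesis by blast
    qed
  qed
  with filt show thesis by (rule that)
qed

section \<open>Sequences with holes\<close>

text \<open>
  Binary digits of a position, with the digits at the places congruent to 1 modulo 4 complemented. Two's
  complement digits are eventually constant, 0 or 1; the complementation makes sure that every integer has digits
  equal to 1 at infinitely many odd places. Thus no position stays a hole for ever, neither to the right nor to
  the left.
\<close>

definition digit :: "nat \<Rightarrow> int \<Rightarrow> bool" where
  "digit k i \<longleftrightarrow> (bit i k \<noteq> (k mod 4 = 1))"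

lemma cong_iff_digits: "i mod 2 ^ k = j mod 2 ^ k \<longleftrightarrow> (\<forall>l<k. digit l i = digit l j)" for i j :: int
  unfolding take_bit_eq_mod[symmetric] bit_eq_iff[of "take_bit k i"] bit_take_bit_iff digit_def by auto

lemma digits_exist: "\<exists>i. \<forall>l<k. digit l i = f l"
proof (induction k)
  case (Suc k)
  then obtain i where i: "\<forall>l<k. digit l i = f l" by blast
  have "\<forall>l<Suc k. digit l (if digit k i = f k then i else flip_bit k i) = f l"
    using i by (auto simp: digit_def bit_flip_bit_iff less_Suc_eq)
  then show ?case by blast
qed simp

lemma digit_add_multiple:
  assumes "2 ^ k dvd i" and "0 \<le> x" and "x < 2 ^ k"
  shows "digit l (i + x) = (if l < k then digit l x else digit l i)"
proof (cases "l < k")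
  case True
  have "(i + x) mod 2 ^ k = x mod 2 ^ k" using assms(1) by (metis dvd_imp_mod_0 mod_add_left_eq add_0)
  then show ?thesis using True unfolding cong_iff_digits by simp
next
  case False
  obtain q where q: "i = 2 ^ k * q" using assms(1) by blast
  have l: "(2::int) ^ l = 2 ^ k * 2 ^ (l - k)" using False by (simp flip: power_add)
  have "(i + x) div 2 ^ l = (i + x) div 2 ^ k div 2 ^ (l - k)"
    unfolding l by (simp add: zdiv_zmult2_eq)
  also have "(i + x) div 2 ^ k = i div 2 ^ k" using assms by (simp add: q)
  also have "i div 2 ^ k div 2 ^ (l - k) = i div 2 ^ l" unfolding l by (simp add: zdiv_zmult2_eq)
  finally show ?thesis using False by (simp add: digit_def bit_iff_odd)
qed

lemma odd_digit_exists: "\<exists>k\<ge>m. odd k \<and> digit k i"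
proof -
  obtain n where n: "\<bar>i\<bar> < 2 ^ n" 
    by (metis less_exp of_nat_less_iff of_nat_numeral of_nat_power zero_le_imp_eq_int abs_ge_zero)
  have big: "bit i k \<longleftrightarrow> i < 0" if "k \<ge> n" for k
  proof -
    have "\<bar>i\<bar> < 2 ^ k" using n power_increasing[OF that, of "2::int"] by linarith
    then have "i div 2 ^ k = (if i < 0 then -1 else 0)"
      by (intro int_div_pos_eq[where r = "if i < 0 then i + 2 ^ k else i"]) auto
    then show ?thesis by (simp add: bit_iff_odd)
  qed
  define k where "k = 4 * (m + n) + (if i < 0 then 3 else 1)"
  have "k \<ge> m" "k \<ge> n" "odd k" "k mod 4 = (if i < 0 then 3 else 1)" by (auto simp: k_def) presburger
  then show ?thesis using big[of k] by (intro exI[of _ k]) (auto simp: digit_def)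
qed

definition level :: "int \<Rightarrow> nat" where
  "level i = (LEAST k. digit k i)"

lemma digit_exists: "\<exists>k. digit k i" using odd_digit_exists by blast

lemma level_eqI:
  assumes "digit k i" "\<And>l. l < k \<Longrightarrow> \<not> digit l i" shows "level i = k"
  unfolding level_def using assms by (intro Least_equality) (auto simp: not_less[symmetric])

lemma level_less: "level i < k \<longleftrightarrow> (\<exists>l<k. digit l i)"
  unfolding level_def using digit_exists[of i] by (metis LeastI Least_le le_less_trans)

lemma level_cong:
  assumes "i mod 2 ^ k = j mod 2 ^ k" "level i < k" shows "level j = level i"
proof (rule level_eqI)
  have d: "digit l i = digit l j" if "l < k" for l using assms(1) that unfolding cong_iff_digits by blast
  have "digit (level i) i" unfolding level_def using digit_exists by (rule LeastI_ex)
  then show "digit (level i) j" using d assms(2) by blast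
  show "\<not> digit l j" if "l < level i" for l
    using d[of l] that assms(2) not_less_Least[of l "\<lambda>k. digit k i"] unfolding level_def by simp
qed

text \<open>
  Suppose that the digits of \<open>i\<close> and \<open>j\<close> first differ at the place \<open>l\<close>.
  Translating both such that the first nonzero digit of \<open>i + s\<close> is at the place \<open>Suc l\<close>,
  the one of \<open>j + s\<close> is at the place \<open>l\<close>, and the parities differ.
\<close>

lemma level_separates:
  assumes "i mod 2 ^ k \<noteq> j mod 2 ^ k"
  shows "\<exists>s. 0 \<le> s \<and> s < 2 ^ Suc k \<and> odd (level (i + s)) \<noteq> odd (level (j + s))"
proof -
  define l where "l = (LEAST l. digit l i \<noteq> digit l j)"
  have ex: "\<exists>l<k. digit l i \<noteq> digit l j" using assms unfolding cong_iff_digits by blast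
  then have "\<exists>l. digit l i \<noteq> digit l j" by blast
  then have l: "digit l i \<noteq> digit l j" unfolding l_def by (rule LeastI_ex)
  obtain r where "r < k" "digit r i \<noteq> digit r j" using ex by blast
  moreover from this(2) have "l \<le> r" unfolding l_def by (rule Least_le)
  ultimately have lk: "l < k" by simp
  have below: "digit r i = digit r j" if "r < l" for r
    using that not_less_Least unfolding l_def by blast
  obtain x where x: "\<forall>r<l + 2. digit r x = (r = Suc l)"
    using digits_exist[of "l + 2" "\<lambda>r. r = Suc l"] by blast
  define s where "s = (x - i) mod 2 ^ (l + 2)"
  have "s < 2 ^ (l + 2)" "0 \<le> s" by (simp_all add: s_def)
  moreover have "(2::int) ^ (l + 2) \<le> 2 ^ Suc k" using lk by (intro power_increasing) auto
  ultimately have s: "0 \<le> s" "s < 2 ^ Suc k" by auto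
  have "(i + s) mod 2 ^ (l + 2) = x mod 2 ^ (l + 2)" unfolding s_def by (simp add: mod_add_right_eq)
  then have di: "\<forall>r<l + 2. digit r (i + s) = (r = Suc l)" using x unfolding cong_iff_digits by simp
  then have "level (i + s) = Suc l" by (intro level_eqI) auto
  moreover have "level (j + s) = l"
  proof (rule level_eqI)
    have "i mod 2 ^ l = j mod 2 ^ l" using below unfolding cong_iff_digits by blast
    then have "(i + s) mod 2 ^ l = (j + s) mod 2 ^ l" by (metis mod_add_left_eq)
    then have low: "\<forall>r<l. digit r (i + s) = digit r (j + s)" unfolding cong_iff_digits .
    then show "\<not> digit r (j + s)" if "r < l" for r using di that by auto
    have "i mod 2 ^ Suc l \<noteq> j mod 2 ^ Suc l" using l unfolding cong_iff_digits by blast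
    then have "(i + s) mod 2 ^ Suc l \<noteq> (j + s) mod 2 ^ Suc l"
      by (metis add_diff_cancel_right' mod_diff_left_eq)
    then have "digit l (i + s) \<noteq> digit l (j + s)"
      using low unfolding cong_iff_digits by (auto simp: less_Suc_eq)
    then show "digit l (j + s)" using di by auto
  qed
  ultimately show ?thesis using s by auto
qed

text \<open>
  The predicate \<open>dbl\<close> selects the doubling steps. As the odd steps are ordinary, every position is
  filled at some step.
\<close>

locale doubling =
  fixes dbl :: "nat \<Rightarrow> bool"
  assumes dbl_even: "dbl k \<Longrightarrow> even k"
begin

definition holes :: "nat \<Rightarrow> nat" where
  "holes k = 2 ^ card {l. l < k \<and> dbl l}"

lemma holes_0: "holes 0 = 1" by (simp add: holes_def)

lemma holes_Suc: "holes (Suc k) = (if dbl k then 2 * holes k else holes k)"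
proof (cases "dbl k")
  case True
  then have "{l. l < Suc k \<and> dbl l} = insert k {l. l < k \<and> dbl l}" by auto
  then show ?thesis using True by (simp add: holes_def)
next
  case False
  then have "{l. l < Suc k \<and> dbl l} = {l. l < k \<and> dbl l}" by (auto simp: less_Suc_eq)
  then show ?thesis using False by (simp add: holes_def)
qed

definition hole :: "nat \<Rightarrow> int \<Rightarrow> bool" where
  "hole k i \<longleftrightarrow> (\<forall>l<k. digit l i \<longrightarrow> dbl l)"

text \<open>
  The digits at the doubling places number the holes of a period in binary.
\<close>

definition hole_index :: "nat \<Rightarrow> int \<Rightarrow> nat" where
  "hole_index k i = (\<Sum>l<k. if dbl l \<and> digit l i then holes l else 0)"

definition fill_level :: "int \<Rightarrow> nat" where
  "fill_level i = (LEAST k. \<not> dbl k \<and> digit k i)"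

text \<open>
  The pattern filled in at step \<open>k\<close>, as a binary number. By the decoding of pairs every number occurs
  at arbitrarily late odd steps.
\<close>

definition pattern :: "nat \<Rightarrow> nat" where
  "pattern k = fst (prod_decode (k div 2))"

text \<open>
  The second component is the filled value. The first one is a marker: the level is itself the filling step of a
  sequence without doubling, and its parity makes the position modulo \<open>2 ^ k\<close> recognizable from a
  window of length proportional to \<open>2 ^ k\<close>.
\<close>

definition seq :: "int \<Rightarrow> bool \<times> bool" where
  "seq i = (odd (level i), bit (pattern (fill_level i)) (hole_index (fill_level i) i))"

lemma fill_level_exists: "\<exists>k. \<not> dbl k \<and> digit k i" using odd_digit_exists dbl_even by blast

lemma fill_level_eqI: "\<not> dbl k \<Longrightarrow> digit k i \<Longrightarrow> hole k i \<Longrightarrow> fill_level i = k"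
  unfolding fill_level_def hole_def by (intro Least_equality) (auto simp: not_less[symmetric])

lemma fill_level_less: "fill_level i < k \<longleftrightarrow> \<not> hole k i"
  unfolding fill_level_def hole_def using fill_level_exists[of i]
  by (metis (mono_tags, lifting) LeastI Least_le le_less_trans)

lemma hole_cong: "i mod 2 ^ k = j mod 2 ^ k \<Longrightarrow> hole k i = hole k j"
  unfolding cong_iff_digits hole_def by auto

lemma hole_index_cong: "i mod 2 ^ k = j mod 2 ^ k \<Longrightarrow> hole_index k i = hole_index k j"
  unfolding cong_iff_digits hole_index_def by (auto intro: sum.cong)

lemma cong_le: "i mod 2 ^ k = j mod 2 ^ k \<Longrightarrow> l \<le> k \<Longrightarrow> i mod 2 ^ l = j mod 2 ^ l" for i j :: int
  unfolding cong_iff_digits by auto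

lemma seq_second_cong:
  assumes c: "i mod 2 ^ k = j mod 2 ^ k" and h: "\<not> hole k i" shows "snd (seq j) = snd (seq i)"
proof -
  define f where "f = fill_level i"
  have fk: "f < k" using h fill_level_less by (simp add: f_def)
  have f: "\<not> dbl f \<and> digit f i" unfolding f_def fill_level_def using fill_level_exists by (rule LeastI_ex)
  have "hole f i" using fill_level_less[of i f] by (simp add: f_def)
  then have "hole f j" using hole_cong[OF cong_le[OF c, of f]] fk by simp
  moreover have "digit f j" using c fk f unfolding cong_iff_digits by simp
  ultimately have "fill_level j = f" using f by (intro fill_level_eqI) auto
  moreover have "hole_index f j = hole_index f i" using hole_index_cong[OF cong_le[OF c, of f]] fk by simp
  ultimately show ?thesis by (simp add: seq_def f_def)
qed

lemma seq_first_cong: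
  assumes "i mod 2 ^ k = j mod 2 ^ k" "level i < k" shows "fst (seq j) = fst (seq i)"
  using level_cong[OF assms] by (simp add: seq_def)

text \<open>
  All positions of a window are filled before some common step \<open>k\<close>, hence the window recurs with
  period \<open>2 ^ k\<close>.
\<close>

lemma recurrent: "\<exists>R. \<forall>j. \<exists>s<R. agree seq c i (j + int s)"
proof -
  let ?I = "{- int c..int c}"
  define k where "k = Suc (Max ((\<lambda>t. max (level (i + t)) (fill_level (i + t))) ` ?I))"
  have k: "level (i + t) < k \<and> fill_level (i + t) < k" if "\<bar>t\<bar> \<le> int c" for t
  proof -
    have "max (level (i + t)) (fill_level (i + t)) \<le> Max ((\<lambda>t. max (level (i + t)) (fill_level (i + t))) ` ?I)"
      using that by (intro Max_ge) (auto intro!: imageI)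
    then show ?thesis by (simp add: k_def)
  qed
  have "\<exists>s<2 ^ k. agree seq c i (j + int s)" for j
  proof (intro exI conjI)
    define s where "s = nat ((i - j) mod 2 ^ k)"
    have s: "int s = (i - j) mod 2 ^ k" by (simp add: s_def)
    then have "int s < int (2 ^ k)" by simp
    then show "s < 2 ^ k" by (simp only: of_nat_less_iff)
    have js: "(j + int s) mod 2 ^ k = i mod 2 ^ k" unfolding s by (simp add: mod_add_right_eq)
    show "agree seq c i (j + int s)"
      unfolding agree_def
    proof (intro allI impI)
      fix t assume t: "\<bar>t\<bar> \<le> int c"
      have c: "(i + t) mod 2 ^ k = (j + int s + t) mod 2 ^ k" using js by (metis mod_add_left_eq)
      show "seq (i + t) = seq (j + int s + t)"
        using seq_first_cong[OF c] seq_second_cong[OF c] k[OF t] fill_level_less[of "i + t" k]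
        by (simp add: prod_eq_iff)
    qed
  qed
  then show ?thesis by blast
qed

lemma seq_separates:
  assumes "agree seq (2 ^ Suc k) i j" shows "i mod 2 ^ k = j mod 2 ^ k"
proof (rule ccontr)
  assume "i mod 2 ^ k \<noteq> j mod 2 ^ k"
  then obtain s where s: "0 \<le> s" "s < 2 ^ Suc k" "odd (level (i + s)) \<noteq> odd (level (j + s))"
    using level_separates by blast
  then have "\<bar>s\<bar> \<le> int (2 ^ Suc k)" by simp
  then have "seq (i + s) = seq (j + s)" using assms unfolding agree_def by blast
  with s(3) show False by (simp add: seq_def)
qed

lemma aperiodic:
  assumes "n \<noteq> 0" shows "\<exists>i. seq (i + n) \<noteq> seq i"
proof (rule ccontr)
  assume "\<not> ?thesis"
  then have per: "seq (i + n) = seq i" for i by blast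
  have "agree seq c 0 n" for c unfolding agree_def using per by (simp add: add.commute)
  then have m: "n mod 2 ^ k = 0" for k using seq_separates[of k 0 n] by simp
  have "\<bar>n\<bar> < 2 ^ nat \<bar>n\<bar>" 
    by (metis less_exp of_nat_less_iff of_nat_numeral of_nat_power nat_0_le abs_ge_zero)
  moreover have "2 ^ nat \<bar>n\<bar> dvd n" using m by blast
  ultimately show False using assms zdvd_imp_le[of "2 ^ nat \<bar>n\<bar>" "\<bar>n\<bar>"] by simp
qed

lemma hole_index_surj: "n < holes k \<Longrightarrow> \<exists>i. hole k i \<and> hole_index k i = n"
proof (induction k arbitrary: n)
  case 0
  then show ?case by (simp add: holes_0 hole_def hole_index_def)
next
  case (Suc k)
  define d where "d = (dbl k \<and> n \<ge> holes k)"
  have "(if d then n - holes k else n) < holes k" using Suc.prems by (auto simp: d_def holes_Suc split: if_splits)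
  with Suc.IH obtain i where i: "hole k i" "hole_index k i = (if d then n - holes k else n)" by blast
  obtain x where x: "\<forall>l<Suc k. digit l x = (if l = k then d else digit l i)"
    using digits_exist[of "Suc k" "\<lambda>l. if l = k then d else digit l i"] by blast
  then have c: "x mod 2 ^ k = i mod 2 ^ k" unfolding cong_iff_digits by simp
  have "hole (Suc k) x" using hole_cong[OF c] i(1) x by (auto simp: hole_def less_Suc_eq d_def)
  moreover have "hole_index (Suc k) x = hole_index k i + (if d then holes k else 0)"
    using hole_index_cong[OF c] x by (auto simp: hole_index_def d_def)
  then have "hole_index (Suc k) x = n" using i(2) by (auto simp: d_def split: if_splits)
  ultimately show ?case by blast
qed

lemma finite_hole_set: "finite {x \<in> {0..<2 ^ k}. hole k x}"
  and card_hole_set: "card {x \<in> {0..<2 ^ k}. hole k x} \<le> holes k"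
proof -
  let ?X = "{x \<in> {0..<2 ^ k}. hole k x}" and ?D = "{l. l < k \<and> dbl l}"
  show fin: "finite ?X" by (rule finite_subset[of _ "{0..<2 ^ k}"]) auto
  have "inj_on (\<lambda>x. {l. l < k \<and> digit l x}) ?X"
  proof (rule inj_onI)
    fix x y assume x: "x \<in> ?X" and y: "y \<in> ?X" and eq: "{l. l < k \<and> digit l x} = {l. l < k \<and> digit l y}"
    then have "x mod 2 ^ k = y mod 2 ^ k" unfolding cong_iff_digits by blast
    then show "x = y" using x y by simp
  qed
  moreover have "(\<lambda>x. {l. l < k \<and> digit l x}) ` ?X \<subseteq> Pow ?D" by (auto simp: hole_def)
  moreover have "finite (Pow ?D)" by simp
  ultimately have "card ?X \<le> card (Pow ?D)" by (rule card_inj_on_le)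
  then show "card ?X \<le> holes k" by (simp add: holes_def card_Pow)
qed

text \<open>
  A window no longer than the period \<open>2 ^ k\<close> meets each residue at most once. It is determined by its
  position modulo \<open>2 ^ k\<close>, by the values in the holes that it meets, and by the marker at the only
  residue where the level is not known before step \<open>k\<close>. The \<open>code\<close> collects these data.
\<close>

lemma complexity_upper:
  assumes "2 * c + 1 \<le> 2 ^ k" shows "complexity seq c \<le> 2 ^ Suc k * 2 ^ holes k"
proof -
  let ?X = "{x \<in> {0..<2 ^ k}. hole k x}"
  define code where "code i = (i mod 2 ^ k,
      {x \<in> ?X. \<exists>s. \<bar>s\<bar> \<le> int c \<and> (i + s) mod 2 ^ k = x \<and> snd (seq (i + s))},
      \<exists>s. \<bar>s\<bar> \<le> int c \<and> \<not> level (i + s) < k \<and> fst (seq (i + s)))" for i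
  have uniq: "s = t" if "\<bar>s\<bar> \<le> int c" "\<bar>t\<bar> \<le> int c" "(i + s) mod 2 ^ k = (i + t) mod 2 ^ k" for i s t
  proof -
    have "s mod 2 ^ k = t mod 2 ^ k" using that(3) by (metis add_diff_cancel_left' mod_diff_left_eq)
    then have d: "2 ^ k dvd s - t" by (simp add: mod_eq_dvd_iff)
    have "int (2 * c + 1) \<le> int (2 ^ k)" using assms by (simp only: of_nat_le_iff)
    then have "\<bar>s - t\<bar> < 2 ^ k" using that(1,2) by simp
    then show ?thesis using d zdvd_imp_le[of "2 ^ k" "\<bar>s - t\<bar>"] by fastforce
  qed
  have key: "window seq c i = window seq c j" if eq: "code i = code j" for i j
    unfolding window_eq_iff agree_def
  proof (intro allI impI)
    fix t assume t: "\<bar>t\<bar> \<le> int c"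
    have ij: "i mod 2 ^ k = j mod 2 ^ k" using eq by (simp add: code_def)
    then have cg: "(i + s) mod 2 ^ k = (j + s) mod 2 ^ k" for s by (metis mod_add_left_eq)
    have "snd (seq (i + t)) = snd (seq (j + t))"
    proof (cases "hole k (i + t)")
      case False
      then show ?thesis using seq_second_cong[OF cg] by simp
    next
      case True
      define x where "x = (i + t) mod 2 ^ k"
      have "hole k x" using True hole_cong[of x k "i + t"] by (simp add: x_def)
      then have xX: "x \<in> ?X" by (simp add: x_def)
      have "snd (seq (l + t)) \<longleftrightarrow> x \<in> fst (snd (code l))" if "x = (l + t) mod 2 ^ k" for l
        using xX t that uniq[of _ t l] unfolding code_def by auto
      from this[of i] this[of j] show ?thesis using eq cg[of t] by (simp add: x_def)
    qed
    moreover have "fst (seq (i + t)) = fst (seq (j + t))"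
    proof (cases "level (i + t) < k")
      case True
      then show ?thesis using seq_first_cong[OF cg] by simp
    next
      case False
      have lj: "level (l + s) < k \<longleftrightarrow> level (l' + s') < k" if "(l + s) mod 2 ^ k = (l' + s') mod 2 ^ k" for l l' s s'
        using that unfolding level_less cong_iff_digits by auto
      have "fst (seq (l + t)) \<longleftrightarrow> snd (snd (code l))" if l: "\<not> level (l + t) < k" for l
      proof -
        have "s = t" if "\<bar>s\<bar> \<le> int c" "\<not> level (l + s) < k" for s
        proof (rule uniq[OF that(1) t])
          show "(l + s) mod 2 ^ k = (l + t) mod 2 ^ k"
            using that(2) l unfolding level_less cong_iff_digits by auto
        qed
        then have "(\<exists>s. \<bar>s\<bar> \<le> int c \<and> \<not> level (l + s) < k \<and> fst (seq (l + s))) \<longleftrightarrow> fst (seq (l + t))"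
          using t l by blast
        then show ?thesis unfolding code_def by simp
      qed
      then show ?thesis using False lj[OF cg] eq by metis
    qed
    ultimately show "seq (i + t) = seq (j + t)" by (simp add: prod_eq_iff)
  qed
  let ?C = "{0..<2 ^ k :: int} \<times> Pow ?X \<times> (UNIV :: bool set)"
  have "range code \<subseteq> ?C" by (auto simp: code_def)
  moreover have finC: "finite ?C" using finite_hole_set by simp
  moreover have "range (window seq c) \<subseteq> (\<lambda>p. window seq c (SOME i. code i = p)) ` range code"
  proof
    fix u assume "u \<in> range (window seq c)"
    then obtain i where "u = window seq c i" by blast
    moreover have "code (SOME j. code j = code i) = code i" by (rule someI) (rule refl)
    then have "window seq c (SOME j. code j = code i) = window seq c i" by (rule key)
    ultimately show "u \<in> (\<lambda>p. window seq c (SOME i. code i = p)) ` range code"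
      by (intro image_eqI[of _ _ "code i"]) auto
  qed
  moreover have fin: "finite (range code)" using calculation(1,2) by (rule finite_subset)
  ultimately have "complexity seq c \<le> card ((\<lambda>p. window seq c (SOME i. code i = p)) ` range code)"
    unfolding complexity_def by (intro card_mono[OF finite_imageI[OF fin]])
  also have "\<dots> \<le> card (range code)" using fin by (rule card_image_le)
  also have "\<dots> \<le> card ?C" using \<open>finite ?C\<close> \<open>range code \<subseteq> ?C\<close> by (rule card_mono)
  also have "card ?C = 2 ^ k * (2 ^ card ?X * 2)"
    using card_Pow[OF finite_hole_set[of k]] by (simp add: card_cartesian_product nat_power_eq)
  also have "\<dots> \<le> 2 ^ k * (2 ^ holes k * 2)"
    using card_hole_set by (intro mult_le_mono order_refl power_increasing) auto
  finally show ?thesis by simp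
qed

text \<open>
  A block with all digits zero from the place \<open>k\<close> up to a step \<open>K\<close> with pattern
  \<open>N\<close>, and digit one at \<open>K\<close>, keeps its holes open until step \<open>K\<close>, without
  changing their numbers.
\<close>

lemma pattern_occurs:
  fixes N :: nat
  shows "\<exists>b. 2 ^ k dvd b \<and> (\<forall>x. 0 \<le> x \<and> x < 2 ^ k \<and> hole k x \<longrightarrow> snd (seq (b + x)) = bit N (hole_index k x))"
proof -
  define K where "K = Suc (2 * prod_encode (N, k))"
  have K: "odd K" "k \<le> K" "pattern K = N"
    using le_prod_encode_2[of k N] by (auto simp: K_def pattern_def)
  \<comment> \<open>The digits below \<open>k\<close> encode a multiple of \<open>2 ^ k\<close>.\<close>
  obtain z where z: "\<forall>l<Suc K. digit l z = (if l < k then l mod 4 = 1 else l = K)"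
    using digits_exist[of "Suc K" "\<lambda>l. if l < k then l mod 4 = 1 else l = K"] by blast
  have "z mod 2 ^ k = 0 mod 2 ^ k" unfolding cong_iff_digits using z K(2) by (auto simp: digit_def)
  then have dvd: "2 ^ k dvd z" by (simp add: mod_0_imp_dvd)
  have "snd (seq (z + x)) = bit N (hole_index k x)" if x: "0 \<le> x" "x < 2 ^ k" "hole k x" for x
  proof -
    have d: "digit l (z + x) = (if l < k then digit l x else l = K)" if "l < Suc K" for l
      using digit_add_multiple[OF dvd x(1,2), of l] z that by auto
    have "hole K (z + x)" using d x(3) by (auto simp: hole_def split: if_splits)
    then have "fill_level (z + x) = K"
      using d[of K] K dbl_even by (intro fill_level_eqI) auto
    moreover have "hole_index K (z + x) = hole_index k x"
      unfolding hole_index_def using K(2) d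
      by (intro sum.mono_neutral_cong_right) (auto split: if_splits)
    ultimately show ?thesis by (simp add: seq_def K(3))
  qed
  with dvd show ?thesis by blast
qed

text \<open>
  The windows at the residue \<open>r\<close> of a block showing the pattern \<open>N\<close> are distinct for
  distinct \<open>(r, N)\<close>: the marker reveals \<open>r\<close>, and then the holes of the block reveal
  \<open>N\<close>.
\<close>

lemma complexity_lower: "2 ^ k * 2 ^ holes k \<le> complexity seq (2 ^ (k + 2))"
proof -
  define c :: nat where "c = 2 ^ (k + 2)"
  obtain b :: "nat \<Rightarrow> int" where b: "\<And>N. 2 ^ k dvd b N"
    "\<And>N x. 0 \<le> x \<Longrightarrow> x < 2 ^ k \<Longrightarrow> hole k x \<Longrightarrow> snd (seq (b N + x)) = bit N (hole_index k x)"
    using pattern_occurs by metis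
  let ?A = "{0..<2 ^ k :: int} \<times> {0..<2 ^ holes k :: nat}"
  have "inj_on (\<lambda>(r, N). window seq c (b N + r)) ?A"
  proof (rule inj_onI, clarify)
    fix r N r' N'
    assume r: "r \<in> {0..<2 ^ k}" "r' \<in> {0..<2 ^ k}" and N: "N \<in> {0..<2 ^ holes k}" "N' \<in> {0..<2 ^ holes k}"
      and "window seq c (b N + r) = window seq c (b N' + r')"
    then have ag: "agree seq c (b N + r) (b N' + r')" by (simp add: window_eq_iff)
    then have "agree seq (2 ^ Suc k) (b N + r) (b N' + r')" by (rule agree_mono) (simp add: c_def)
    then have "(b N + r) mod 2 ^ k = (b N' + r') mod 2 ^ k" by (rule seq_separates)
    moreover have "(b N + r) mod 2 ^ k = r mod 2 ^ k" for N r
      using b(1)[of N] by (metis add_0 dvd_imp_mod_0 mod_add_left_eq)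
    ultimately have "r mod 2 ^ k = r' mod 2 ^ k" by metis
    then have rr: "r = r'" using r by simp
    have "bit N n = bit N' n" if n: "n < holes k" for n
    proof -
      obtain i where i: "hole k i" "hole_index k i = n" using hole_index_surj[OF n] by blast
      define x where "x = i mod 2 ^ k"
      have x: "0 \<le> x" "x < 2 ^ k" "hole k x" "hole_index k x = n"
        using i hole_cong[of x k i] hole_index_cong[of x k i] by (auto simp: x_def)
      have "\<bar>x - r\<bar> \<le> int c"
      proof -
        have "(2::int) ^ k \<le> 2 ^ (k + 2)" by (rule power_increasing) auto
        then have "2 ^ k \<le> int c" by (simp add: c_def)
        then show ?thesis using x(1,2) r unfolding atLeastLessThan_iff by linarith
      qed
      then have "seq (b N + r + (x - r)) = seq (b N' + r' + (x - r))" using ag unfolding agree_def by blast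
      then have "snd (seq (b N + x)) = snd (seq (b N' + x))" by (simp add: rr)
      then show ?thesis using b(2)[OF x(1-3)] x(4) by metis
    qed
    then have "take_bit (holes k) N = take_bit (holes k) N'"
      by (auto simp: bit_eq_iff bit_take_bit_iff)
    then show "r = r' \<and> N = N'" using N rr by (simp add: take_bit_nat_eq_self)
  qed
  moreover have "(\<lambda>(r, N). window seq c (b N + r)) ` ?A \<subseteq> range (window seq c)" by auto
  ultimately have "card ?A \<le> complexity seq c"
    unfolding complexity_def using finite_range_window by (rule card_inj_on_le)
  moreover have "card ?A = 2 ^ k * 2 ^ holes k" by (simp add: card_cartesian_product nat_power_eq)
  ultimately show ?thesis by (simp add: c_def)
qed

end

section \<open>Prescribing the number of holes\<close>

text \<open>
  A greedy choice of the doubling steps, by which the number of holes follows \<open>\<delta> * k\<close> from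
  below.
\<close>

primrec rate_holes :: "real \<Rightarrow> nat \<Rightarrow> nat" where
  "rate_holes \<delta> 0 = 1"
| "rate_holes \<delta> (Suc k) =
    (if even k \<and> 2 * real (rate_holes \<delta> k) \<le> \<delta> * real (Suc k) then 2 * rate_holes \<delta> k else rate_holes \<delta> k)"

definition rate_dbl :: "real \<Rightarrow> nat \<Rightarrow> bool" where
  "rate_dbl \<delta> k \<longleftrightarrow> even k \<and> 2 * real (rate_holes \<delta> k) \<le> \<delta> * real (Suc k)"

lemma rate_holes_Suc: "rate_holes \<delta> (Suc k) = (if rate_dbl \<delta> k then 2 * rate_holes \<delta> k else rate_holes \<delta> k)"
  by (simp add: rate_dbl_def)

declare rate_holes.simps(2) [simp del]

lemma rate_dbl_even: "rate_dbl \<delta> k \<Longrightarrow> even k"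
  by (simp add: rate_dbl_def)

lemma doubling_rate_dbl: "doubling (rate_dbl \<delta>)"
  by unfold_locales (simp add: rate_dbl_def)

lemma holes_rate_dbl: "doubling.holes (rate_dbl \<delta>) k = rate_holes \<delta> k"
  by (induction k)
    (simp_all add: doubling.holes_0[OF doubling_rate_dbl] doubling.holes_Suc[OF doubling_rate_dbl] rate_holes_Suc)

lemma rate_holes_pos: "rate_holes \<delta> k \<ge> 1"
  by (induction k) (auto simp: rate_holes_Suc)

lemma rate_holes_upper: "\<delta> \<ge> 0 \<Longrightarrow> real (rate_holes \<delta> k) \<le> max 1 (\<delta> * real k)"
proof (induction k)
  case (Suc k)
  have "\<delta> * real k \<le> \<delta> * real (Suc k)" using Suc.prems by (intro mult_left_mono) auto
  then show ?case using Suc by (auto simp: rate_holes_Suc rate_dbl_def)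
qed simp

lemma eventually_linear_less_power:
  "eventually (\<lambda>n. a + b * real n < 2 ^ n) sequentially"
proof -
  have "(\<lambda>n. a / 2 ^ n + b * (real n / 2 ^ n)) \<longlonglongrightarrow> 0 + b * 0"
    by (intro tendsto_add tendsto_mult tendsto_const LIMSEQ_divide_realpow_zero)
      (use lim_n_over_pown[of "2::real"] in auto)
  then have "eventually (\<lambda>n. a / 2 ^ n + b * (real n / 2 ^ n) < 1) sequentially"
    by (intro order_tendstoD(2)) auto
  then show ?thesis by eventually_elim (simp add: field_simps)
qed

text \<open>
  Right after a doubling step that is not preceded by another one two steps before, the bound is nearly attained,
  as the earlier step would have been a doubling step otherwise. For \<open>\<delta> > 0\<close> such steps occur
  arbitrarily late.
\<close>

lemma rate_holes_lower:
  assumes "\<delta> \<ge> 0" shows "\<exists>k\<ge>m. \<delta> * real k - 2 * \<delta> \<le> real (rate_holes \<delta> k)"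
proof (cases "\<delta> = 0")
  case True
  then show ?thesis by (intro exI[of _ m]) auto
next
  case False
  then have \<delta>: "\<delta> > 0" using assms by simp
  let ?h = "rate_holes \<delta>"
  \<comment> \<open>Doubling at every admissible step would be exponential.\<close>
  have "\<exists>k. even k \<and> k \<ge> m \<and> \<not> rate_dbl \<delta> k"
  proof (rule ccontr)
    assume "\<not> ?thesis"
    then have dbl: "rate_dbl \<delta> k" if "even k" "k \<ge> m" for k using that by blast
    have ge: "?h (2 * m + 2 * j) \<ge> 2 ^ j" for j
    proof (induction j)
      case 0
      show ?case using rate_holes_pos by simp
    next
      case (Suc j)
      have e: "even (2 * m + 2 * j)" "2 * m + 2 * j \<ge> m" by auto
      have "2 * ?h (2 * m + 2 * j) = ?h (Suc (2 * m + 2 * j))" using dbl[OF e] by (simp add: rate_holes_Suc)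
      also have "\<dots> \<le> ?h (Suc (Suc (2 * m + 2 * j)))" by (subst (2) rate_holes_Suc) simp
      also have "Suc (Suc (2 * m + 2 * j)) = 2 * m + 2 * Suc j" by simp
      finally show ?case using Suc by simp
    qed
    obtain j where "\<forall>i\<ge>j. 1 + 2 * \<delta> * real m + 2 * \<delta> * real i < 2 ^ i"
      using eventually_linear_less_power[of "1 + 2 * \<delta> * real m" "2 * \<delta>"]
      unfolding eventually_sequentially by (rule exE)
    then have j: "1 + 2 * \<delta> * real m + 2 * \<delta> * real j < 2 ^ j" by simp
    have "2 ^ j = real (2 ^ j)" by simp
    also have "\<dots> \<le> real (?h (2 * m + 2 * j))" using ge[of j] by (simp only: of_nat_le_iff)
    also have "\<dots> \<le> max 1 (\<delta> * real (2 * m + 2 * j))" by (rule rate_holes_upper[OF assms])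
    also have "\<dots> \<le> 1 + \<delta> * real (2 * m + 2 * j)" using assms by simp
    finally show False using j by (simp add: algebra_simps)
  qed
  then obtain k1 where k1: "even k1" "k1 \<ge> m" "\<not> rate_dbl \<delta> k1" by blast
  \<comment> \<open>Without further doubling the number of holes would be constant and fall behind.\<close>
  have "\<exists>k. even k \<and> k > k1 \<and> rate_dbl \<delta> k"
  proof (rule ccontr)
    assume "\<not> ?thesis"
    then have no: "\<not> rate_dbl \<delta> k" if "k \<ge> k1" for k
      using that k1(3) by (cases "k = k1") (auto simp: rate_dbl_def)
    have const: "?h (k1 + j) = ?h k1" for j
    proof (induction j)
      case (Suc j)
      have "\<not> rate_dbl \<delta> (k1 + j)" by (rule no) simp
      with Suc show ?case by (simp add: rate_holes_Suc)
    qed simp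
    obtain j :: nat where "real j \<ge> 2 * real (?h k1) / \<delta>" using real_arch_simple by blast
    then have "2 * real (?h k1) \<le> \<delta> * real j" using \<delta> by (simp add: field_simps)
    also have "\<dots> \<le> \<delta> * real (Suc (k1 + 2 * j))" using \<delta> by (intro mult_left_mono) auto
    finally have "rate_dbl \<delta> (k1 + 2 * j)" using const k1(1) by (simp add: rate_dbl_def)
    then show False using no[of "k1 + 2 * j"] by simp
  qed
  then have ex: "\<exists>k. even k \<and> k > k1 \<and> rate_dbl \<delta> k" .
  define k where "k = (LEAST k. even k \<and> k > k1 \<and> rate_dbl \<delta> k)"
  have k: "even k" "k > k1" "rate_dbl \<delta> k"
    using LeastI_ex[OF ex] unfolding k_def by auto
  have least: "k \<le> l" if "even l" "l > k1" "rate_dbl \<delta> l" for l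
    unfolding k_def using that by (intro Least_le) auto
  obtain l where l: "k = Suc (Suc l)"
    using k(1,2) by (cases k; cases "k - 1") auto
  have "even l" "l \<ge> k1" using l k(1,2) k1(1) by (auto simp: less_Suc_eq)
  then have "\<not> rate_dbl \<delta> l" using least[of l] k1(3) l by (cases "l = k1") auto
  then have "\<delta> * real (Suc l) < 2 * real (?h l)" using \<open>even l\<close> by (simp add: rate_dbl_def)
  also have "?h k = ?h l"
    using \<open>\<not> rate_dbl \<delta> l\<close> rate_dbl_even[of \<delta> "Suc l"] \<open>even l\<close> by (auto simp: l rate_holes_Suc)
  then have "2 * real (?h l) = real (?h (Suc k))" using k(3) by (simp add: rate_holes_Suc)
  finally have "\<delta> * real (Suc k) - 2 * \<delta> \<le> real (?h (Suc k))" by (simp add: l algebra_simps)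
  then show ?thesis using k(2) k1(2) by (intro exI[of _ "Suc k"]) auto
qed

lemma rate_dimension_upper:
  assumes \<delta>: "\<delta> \<ge> 0" and n: "n \<ge> 1"
  shows "real ((2 * n + 1) * complexity (doubling.seq (rate_dbl \<delta>)) n) \<le> 72 * 6 powr \<delta> * real n powr (\<delta> + 2)"
proof -
  interpret doubling "rate_dbl \<delta>" by (rule doubling_rate_dbl)
  define k where "k = (LEAST k. 2 * n + 1 \<le> (2::nat) ^ k)"
  have "2 * n + 1 \<le> (2::nat) ^ (2 * n + 1)" using less_exp[of "2 * n + 1"] by simp
  then have k: "2 * n + 1 \<le> 2 ^ k" unfolding k_def by (rule LeastI)
  have "k \<noteq> 0"
  proof
    assume "k = 0"
    then show False using k n by simp
  qed
  then have "\<not> 2 * n + 1 \<le> (2::nat) ^ (k - 1)" unfolding k_def by (intro not_less_Least) simp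
  then have "(2::nat) ^ (k - 1) \<le> 3 * n" using n by simp
  moreover have "(2::nat) ^ k = 2 * 2 ^ (k - 1)" using \<open>k \<noteq> 0\<close> by (cases k) auto
  ultimately have "(2::nat) ^ k \<le> 6 * n" by linarith
  then have k6: "(2::real) ^ k \<le> 6 * real n" by (metis of_nat_le_iff of_nat_mult of_nat_numeral of_nat_power)
  have "2 powr real (rate_holes \<delta> k) \<le> 2 powr (1 + \<delta> * real k)"
  proof (rule powr_mono)
    have "0 \<le> \<delta> * real k" using \<delta> by simp
    then show "real (rate_holes \<delta> k) \<le> 1 + \<delta> * real k" using rate_holes_upper[OF \<delta>, of k] by linarith
  qed simp
  also have "\<dots> = 2 * (2 powr real k) powr \<delta>" by (simp add: powr_add powr_powr mult.commute)
  also have "\<dots> = 2 * (2 ^ k) powr \<delta>" by (simp add: powr_realpow)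
  also have "\<dots> \<le> 2 * (6 * real n) powr \<delta>" using k6 \<delta> by (intro mult_left_mono powr_mono2) auto
  also have "\<dots> = 2 * 6 powr \<delta> * real n powr \<delta>" by (simp add: powr_mult)
  finally have h: "(2::real) ^ rate_holes \<delta> k \<le> 2 * 6 powr \<delta> * real n powr \<delta>" by (simp add: powr_realpow)
  have "complexity seq n \<le> 2 ^ Suc k * 2 ^ rate_holes \<delta> k"
    using complexity_upper[OF k] by (simp add: holes_rate_dbl)
  then have "real (complexity seq n) \<le> real (2 ^ Suc k * 2 ^ rate_holes \<delta> k)" by (simp only: of_nat_le_iff)
  also have "\<dots> = 2 * 2 ^ k * 2 ^ rate_holes \<delta> k" by simp
  also have "\<dots> \<le> 2 * (6 * real n) * (2 * 6 powr \<delta> * real n powr \<delta>)"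
    using k6 h by (intro mult_mono) auto
  finally have "real (complexity seq n) \<le> 24 * 6 powr \<delta> * (real n * real n powr \<delta>)" by (simp add: mult_ac)
  then have "real (2 * n + 1) * real (complexity seq n) \<le> (3 * real n) * (24 * 6 powr \<delta> * (real n * real n powr \<delta>))"
    using n by (intro mult_mono) auto
  also have "\<dots> = 72 * 6 powr \<delta> * (real n ^ 2 * real n powr \<delta>)" by (simp add: power2_eq_square mult_ac)
  also have "real n ^ 2 * real n powr \<delta> = real n powr (\<delta> + 2)" using n by (simp add: powr_add)
  finally show ?thesis by (simp only: of_nat_mult)
qed

lemma rate_dimension_lower:
  assumes \<delta>: "\<delta> \<ge> 0"
  shows "\<exists>n\<ge>m. (1 / 4) * 16 powr (- \<delta>) * real n powr (\<delta> + 2)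
      \<le> real ((2 * n + 1) * complexity (doubling.seq (rate_dbl \<delta>)) n)"
proof -
  interpret doubling "rate_dbl \<delta>" by (rule doubling_rate_dbl)
  obtain k where k: "k \<ge> m" "\<delta> * real k - 2 * \<delta> \<le> real (rate_holes \<delta> k)"
    using rate_holes_lower[OF \<delta>] by blast
  define n :: nat where "n = 2 ^ (k + 2)"
  have n: "real n = 4 * 2 ^ k" by (simp add: n_def)
  have "16 powr (- \<delta>) * real n powr \<delta> = (real n / 16) powr \<delta>"
    by (simp add: powr_divide powr_minus_divide)
  also have "real n / 16 = 2 powr (real k - 2)" by (simp add: n powr_diff powr_realpow)
  also have "(2 powr (real k - 2)) powr \<delta> = 2 powr (\<delta> * real k - 2 * \<delta>)" by (simp add: powr_powr algebra_simps)
  also have "\<dots> \<le> 2 powr real (rate_holes \<delta> k)" using k(2) by (intro powr_mono) auto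
  finally have h: "16 powr (- \<delta>) * real n powr \<delta> \<le> 2 ^ rate_holes \<delta> k" by (simp add: powr_realpow)
  have "2 ^ k * 2 ^ rate_holes \<delta> k \<le> complexity seq n"
    using complexity_lower[of k] by (simp add: holes_rate_dbl n_def)
  then have "real (2 ^ k * 2 ^ rate_holes \<delta> k) \<le> real (complexity seq n)" by (simp only: of_nat_le_iff)
  then have c: "(real n / 4) * 2 ^ rate_holes \<delta> k \<le> real (complexity seq n)" by (simp add: n)
  have "(1 / 4) * 16 powr (- \<delta>) * real n powr (\<delta> + 2) = real n * ((real n / 4) * (16 powr (- \<delta>) * real n powr \<delta>))"
    using n by (simp add: powr_add power2_eq_square)
  also have "\<dots> \<le> real n * ((real n / 4) * 2 ^ rate_holes \<delta> k)" using h by (intro mult_left_mono) auto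
  also have "\<dots> \<le> real (2 * n + 1) * real (complexity seq n)" using c by (intro mult_mono) auto
  finally have "(1 / 4) * 16 powr (- \<delta>) * real n powr (\<delta> + 2) \<le> real ((2 * n + 1) * complexity seq n)"
    by (simp only: of_nat_mult)
  moreover have "n \<ge> m" using k(1) less_exp[of "k + 2"] by (simp add: n_def)
  ultimately show ?thesis by blast
qed

lemma complexity_mono: "m \<le> n \<Longrightarrow> complexity (w :: int \<Rightarrow> 'l::finite) m \<le> complexity w n"
proof -
  assume mn: "m \<le> n"
  let ?f = "\<lambda>u t. if \<bar>t\<bar> \<le> int m then u t else None"
  have "window w m i = ?f (window w n i)" for i using mn by (auto simp: window_def fun_eq_iff)
  then have "range (window w m) \<subseteq> ?f ` range (window w n)" by auto
  then show ?thesis unfolding complexity_def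
    using finite_range_window[of w n] by (meson card_image_le card_mono finite_imageI le_trans)
qed

lemma quadratic_dimension_lower:
  assumes "n \<ge> 1"
  shows "(1 / 8) * real n ^ 2 \<le> real ((2 * n + 1) * complexity (doubling.seq (rate_dbl \<delta>)) n)"
proof -
  interpret doubling "rate_dbl \<delta>" by (rule doubling_rate_dbl)
  have "real n / 8 \<le> real (complexity seq n)"
  proof (cases "n < 4")
    case True
    have "complexity seq n \<ge> 1" unfolding complexity_def
      using finite_range_window[of seq n] by (simp add: Suc_le_eq card_gt_0_iff)
    then show ?thesis using True by simp
  next
    case False
    define k where "k = (LEAST k. n < (2::nat) ^ (k + 3))"
    have "n < n + 3" by simp
    also have "n + 3 < (2::nat) ^ (n + 3)" by (rule less_exp)
    finally have "n < (2::nat) ^ (n + 3)" .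
    then have k: "n < 2 ^ (k + 3)" unfolding k_def by (rule LeastI)
    have "2 ^ (k + 2) \<le> n"
    proof (cases k)
      case 0 then show ?thesis using False by simp
    next
      case (Suc j)
      then have "\<not> n < (2::nat) ^ (j + 3)" unfolding k_def[symmetric] using not_less_Least[of j "\<lambda>k. n < (2::nat) ^ (k + 3)"] k_def by simp
      then show ?thesis using Suc by (simp add: numeral_eq_Suc)
    qed
    then have "complexity seq (2 ^ (k + 2)) \<le> complexity seq n" by (rule complexity_mono)
    then have "2 ^ k * 2 ^ holes k \<le> complexity seq n" using complexity_lower[of k] by linarith
    moreover have "2 ^ k * 1 \<le> 2 ^ k * (2::nat) ^ holes k" by (intro mult_le_mono2) simp
    ultimately have "2 ^ k \<le> complexity seq n" by linarith
    moreover have "n < 8 * 2 ^ k" using k by (simp add: power_add)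
    ultimately have "n \<le> 8 * complexity seq n" by linarith
    then have "real n \<le> real (8 * complexity seq n)" by (simp only: of_nat_le_iff)
    then show ?thesis by simp
  qed
  then have "real n * (real n / 8) \<le> real (2 * n + 1) * real (complexity seq n)" by (intro mult_mono) auto
  then have "1 / 8 * real n ^ 2 \<le> real (2 * n + 1) * real (complexity seq n)" by (simp add: power2_eq_square)
  then show ?thesis by (simp only: of_nat_mult)
qed

lemma infinite_dimension_lower:
  assumes d: "d \<ge> 0"
  shows "\<exists>n\<ge>m. real n powr d \<le> real ((2 * n + 1) * complexity (doubling.seq even) n)"
proof -
  interpret doubling even by unfold_locales simp
  have h: "holes (2 * k) = 2 ^ k" for k
  proof (induction k)
    case (Suc k)
    then show ?case using holes_Suc[of "Suc (2 * k)"] holes_Suc[of "2 * k"] by simp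
  qed (simp add: holes_0)
  obtain K where K: "\<And>k. k \<ge> K \<Longrightarrow> 2 * d + 2 * d * real k < 2 ^ k"
    using eventually_linear_less_power[of "2 * d" "2 * d"] unfolding eventually_sequentially by blast
  define k where "k = max m K"
  have k: "k \<ge> m" "d * (2 * real k + 2) \<le> 2 ^ k"
    using K[of k] by (auto simp: k_def algebra_simps)
  define n :: nat where "n = 2 ^ (2 * k + 2)"
  have "real n = 2 ^ (2 * k + 2)" by (simp add: n_def)
  also have "\<dots> = 2 powr real (2 * k + 2)" by (rule powr_realpow[symmetric]) simp
  also have "real (2 * k + 2) = 2 * real k + 2" by simp
  finally have "real n = 2 powr (2 * real k + 2)" .
  then have "real n powr d = 2 powr (d * (2 * real k + 2))" by (simp add: powr_powr mult.commute)
  also have "\<dots> \<le> 2 powr (2 ^ k)" using k(2) by (intro powr_mono) auto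
  also have "\<dots> = 2 powr real (holes (2 * k))" by (simp add: h)
  also have "\<dots> = 2 ^ holes (2 * k)" by (rule powr_realpow) simp
  also have "\<dots> = real (2 ^ holes (2 * k))" by simp
  also have "\<dots> \<le> real (complexity seq n)"
  proof -
    have "1 * 2 ^ holes (2 * k) \<le> (2::nat) ^ (2 * k) * 2 ^ holes (2 * k)" by (intro mult_le_mono1) simp
    then have "2 ^ holes (2 * k) \<le> complexity seq n" using complexity_lower[of "2 * k"] unfolding n_def by linarith
    then show ?thesis by (simp only: of_nat_le_iff)
  qed
  also have "\<dots> \<le> real ((2 * n + 1) * complexity seq n)" by (simp only: of_nat_le_iff) simp
  finally have "real n powr d \<le> real ((2 * n + 1) * complexity seq n)" .
  moreover have "n \<ge> m" using k(1) less_exp[of "2 * k + 2"] by (simp add: n_def)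
  ultimately show ?thesis by blast
qed

theorem mainTheorem3:
  shows "(\<forall>d::ereal. 2 \<le> d \<longrightarrow>
           (\<exists>(scale :: 'k::field \<Rightarrow> 'k countable_space \<Rightarrow> 'k countable_space) mult unit.
              unital_algebra scale mult unit \<and>
              unital_algebra.simple_algebra scale mult \<and>
              unital_algebra.finitely_generated scale mult unit \<and>
              unital_algebra.has_gk_dim scale mult unit d)) \<and>
         (\<exists>(scale :: 'k \<Rightarrow> 'k countable_space \<Rightarrow> 'k countable_space) mult unit.
              unital_algebra scale mult unit \<and>
              unital_algebra.simple_algebra scale mult \<and>
              unital_algebra.finitely_generated scale mult unit \<and>
              unital_algebra.quadratic_growth scale mult unit)"
proof (intro conjI allI impI)
  fix d :: ereal assume d: "2 \<le> d"
  show "\<exists>(scale :: 'k \<Rightarrow> 'k countable_space \<Rightarrow> 'k countable_space) mult unit.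
              unital_algebra scale mult unit \<and>
              unital_algebra.simple_algebra scale mult \<and>
              unital_algebra.finitely_generated scale mult unit \<and>
              unital_algebra.has_gk_dim scale mult unit d"
  proof (cases d)
    case (real r)
    define \<delta> where "\<delta> = r - 2"
    have \<delta>: "\<delta> \<ge> 0" "r = \<delta> + 2" using d real by (auto simp: \<delta>_def)
    interpret doubling "rate_dbl \<delta>" by (rule doubling_rate_dbl)
    obtain scale :: "'k \<Rightarrow> 'k countable_space \<Rightarrow> 'k countable_space" and mult unit F S0
      where A: "filtered_algebra scale mult unit F (\<lambda>c. (2 * c + 1) * complexity seq c) S0 9"
        "unital_algebra.simple_algebra scale mult"
      by (rule simple_local_algebra[OF recurrent aperiodic])
    interpret A: filtered_algebra scale mult unit F "\<lambda>c. (2 * c + 1) * complexity seq c" S0 9 by (rule A(1))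
    have "A.has_gk_dim (ereal r)" unfolding \<delta>(2)
    proof (rule A.has_gk_dimI)
      show "\<delta> + 2 \<ge> 0" using \<delta> by simp
      show "(1 / 4) * 16 powr (- \<delta>) > 0" by simp
    qed (use rate_dimension_upper[OF \<delta>(1)] rate_dimension_lower[OF \<delta>(1)] in auto)
    then show ?thesis using A(2) A.finitely_generated A.unital_algebra_axioms real by blast
  next
    case PInf
    interpret doubling even by unfold_locales simp
    obtain scale :: "'k \<Rightarrow> 'k countable_space \<Rightarrow> 'k countable_space" and mult unit F S0
      where A: "filtered_algebra scale mult unit F (\<lambda>c. (2 * c + 1) * complexity seq c) S0 9"
        "unital_algebra.simple_algebra scale mult"
      by (rule simple_local_algebra[OF recurrent aperiodic])
    interpret A: filtered_algebra scale mult unit F "\<lambda>c. (2 * c + 1) * complexity seq c" S0 9 by (rule A(1))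
    have "A.has_gk_dim \<infinity>" by (rule A.has_gk_dim_infinityI) (rule infinite_dimension_lower)
    then show ?thesis using A(2) A.finitely_generated A.unital_algebra_axioms PInf by blast
  next
    case MInf
    with d show ?thesis by simp
  qed
next
  interpret doubling "rate_dbl 0" by (rule doubling_rate_dbl)
  obtain scale :: "'k \<Rightarrow> 'k countable_space \<Rightarrow> 'k countable_space" and mult unit F S0
    where A: "filtered_algebra scale mult unit F (\<lambda>c. (2 * c + 1) * complexity seq c) S0 9"
      "unital_algebra.simple_algebra scale mult"
    by (rule simple_local_algebra[OF recurrent aperiodic])
  interpret A: filtered_algebra scale mult unit F "\<lambda>c. (2 * c + 1) * complexity seq c" S0 9 by (rule A(1))
  have "A.quadratic_growth"
  proof (rule A.quadratic_growthI)
    show "(1 / 8 :: real) > 0" by simp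
    show "real ((2 * n + 1) * complexity seq n) \<le> 72 * real n ^ 2" if "n \<ge> 1" for n
      using rate_dimension_upper[of 0 n] that by simp
  qed (rule quadratic_dimension_lower)
  then show "\<exists>(scale :: 'k \<Rightarrow> 'k countable_space \<Rightarrow> 'k countable_space) mult unit.
              unital_algebra scale mult unit \<and>
              unital_algebra.simple_algebra scale mult \<and>
              unital_algebra.finitely_generated scale mult unit \<and>
              unital_algebra.quadratic_growth scale mult unit"
    using A(2) A.finitely_generated A.unital_algebra_axioms by blast
qed

end
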